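(* Let $\Gamma_\sigma$ be the frozen Jacobian algebra associated with a triangulation $\sigma$ of a polygon $P$ with $n\ge 3$ vertices (see context). Then $\Gamma_\sigma$ has the structure of a tiled $R$-order, where $R=K[x]$: there is an $R$-algebra structure on $\Gamma_\sigma$ under which $\Gamma_\sigma$ is isomorphic, as an $R$-algebra, to a tiled $R$-order.
   Context: Let $K$ be a field and $R=K[x]$. Let $P$ be a regular polygon with $n\ge3$ vertices $P_1,\dots,P_n$ labelled counterclockwise. A diagonal is a segment joining two vertices of $P$ and lying in the interior of $P$; two diagonals cross if they share an interior point. A triangulation $\sigma$ of $P$ is a decomposition of $P$ into triangles by a maximal set of pairwise non-crossing diagonals; its edges are the $n$ sides of $P$ and its diagonals. The quiver $Q_\sigma$ has as vertices the edges of $\sigma$. Whenever two edges $a,b$ are sides of a common triangle of $\sigma$, there is an internal arrow $a\to b$ if $a$ is a predecessor of $b$ with respect to anticlockwise orientation centered at their common vertex. For every vertex of $P$ incident to at least one diagonal of $\sigma$ there is an external arrow $a\to b$, where $a,b$ are the two sides of $P$ at that vertex and $a$ precedes $b$ anticlockwise around the vertex. A minimal cycle of $Q_\sigma$ is a cycle in which no arrow appears twice and which encloses a region of the plane whose interior is connected and contains no arrow; these are the cyclic triangles (three internal arrows inside a triangle of $\sigma$) and the big cycles (internal arrows and one external arrow around a vertex of $P$). Put $W_\sigma=\sum(\text{cyclic triangles})-\sum(\text{big cycles})$ and let $F$ be the set of vertices of $Q_\sigma$ corresponding to the sides of $P$ (frozen vertices). For an arrow $a$, the cyclic derivative is the linear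 map with $\partial_a(a_1\cdots a_d)=\sum_{a_i=a}a_{i+1}\cdots a_da_1\cdots a_{i-1}$ on cycles. The frozen Jacobian algebra is $\Gamma_\sigma=KQ_\sigma/J$, where $J$ is the two-sided ideal generated by $\partial_aW_\sigma$ for all arrows $a$ with source or target not in $F$. An $R$-order is an $R$-algebra which is finitely generated and free as an $R$-module. A tiled $R$-order is an $R$-subalgebra of $M_m(K(x))$ of the form $((x^{a_{ij}}R))_{i,j=1}^m$ (the $(i,j)$ entries range over $x^{a_{ij}}R$) with $a_{ij}\in\mathbb Z$ satisfying $a_{ij}+a_{jt}\ge a_{it}$ for all $i,j,t$. *)

theory Defs
  imports "HOL-Computational_Algebra.Polynomial" "HOL-Computational_Algebra.Fraction_Field"
begin

text \<open>Vertices of the polygon P are 0,...,n-1 (counterclockwise). An edge {i,j} is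
  encoded as the pair (i,j) with i < j.\<close>

type_synonym pedge = "nat \<times> nat"

definition mk_edge :: "nat \<Rightarrow> nat \<Rightarrow> pedge" where
  "mk_edge i j = (min i j, max i j)"

definition is_side :: "nat \<Rightarrow> pedge \<Rightarrow> bool" where
  "is_side n e \<longleftrightarrow> fst e < snd e \<and> snd e < n \<and>
     (snd e = Suc (fst e) \<or> (fst e = 0 \<and> snd e = n - 1))"

definition is_diag :: "nat \<Rightarrow> pedge \<Rightarrow> bool" where
  "is_diag n e \<longleftrightarrow> fst e < snd e \<and> snd e < n \<and> \<not> is_side n e"

definition crosses :: "pedge \<Rightarrow> pedge \<Rightarrow> bool" where
  "crosses d e \<longleftrightarrow>
     (fst d < fst e \<and> fst e < snd d \<and> snd d < snd e) \<or>
     (fst e < fst d \<and> fst d < snd e \<and> snd e < snd d)"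

definition is_triangulation :: "nat \<Rightarrow> pedge set \<Rightarrow> bool" where
  "is_triangulation n D \<longleftrightarrow>
     D \<subseteq> {d. is_diag n d} \<and>
     (\<forall>d\<in>D. \<forall>e\<in>D. \<not> crosses d e) \<and>
     (\<forall>d. is_diag n d \<and> d \<notin> D \<longrightarrow> (\<exists>e\<in>D. crosses d e))"

definition sides :: "nat \<Rightarrow> pedge set" where
  "sides n = {e. is_side n e}"

definition edges :: "nat \<Rightarrow> pedge set \<Rightarrow> pedge set" where
  "edges n D = sides n \<union> D"

definition ends :: "pedge \<Rightarrow> nat set" where
  "ends e = {fst e, snd e}"

definition other_end :: "pedge \<Rightarrow> nat \<Rightarrow> nat" where
  "other_end e v = (if fst e = v then snd e else fst e)"

text \<open>Anticlockwise angular position, seen from polygon vertex v, of polygon vertex p.\<close>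
definition ccw_dist :: "nat \<Rightarrow> nat \<Rightarrow> nat \<Rightarrow> nat" where
  "ccw_dist n v p = (p + n - v) mod n"

definition is_triangle :: "nat \<Rightarrow> pedge set \<Rightarrow> nat \<Rightarrow> nat \<Rightarrow> nat \<Rightarrow> bool" where
  "is_triangle n D a b c \<longleftrightarrow> a < b \<and> b < c \<and> c < n \<and>
     (a,b) \<in> edges n D \<and> (b,c) \<in> edges n D \<and> (a,c) \<in> edges n D"

definition triangles :: "nat \<Rightarrow> pedge set \<Rightarrow> (nat \<times> nat \<times> nat) set" where
  "triangles n D = {(a,b,c). is_triangle n D a b c}"

definition internal_arrow :: "nat \<Rightarrow> pedge set \<Rightarrow> pedge \<Rightarrow> pedge \<Rightarrow> bool" where
  "internal_arrow n D e f \<longleftrightarrow>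
     (\<exists>a b c. is_triangle n D a b c \<and> e \<in> {(a,b),(b,c),(a,c)} \<and>
        f \<in> {(a,b),(b,c),(a,c)} \<and> e \<noteq> f \<and>
        (\<exists>v. v \<in> ends e \<and> v \<in> ends f \<and>
              ccw_dist n v (other_end e v) < ccw_dist n v (other_end f v)))"

definition side_before :: "nat \<Rightarrow> nat \<Rightarrow> pedge" where
  "side_before n v = mk_edge ((v + n - 1) mod n) v"

definition side_after :: "nat \<Rightarrow> nat \<Rightarrow> pedge" where
  "side_after n v = mk_edge v ((v + 1) mod n)"

definition has_diag :: "pedge set \<Rightarrow> nat \<Rightarrow> bool" where
  "has_diag D v \<longleftrightarrow> (\<exists>d\<in>D. v \<in> ends d)"

definition external_arrow :: "nat \<Rightarrow> pedge set \<Rightarrow> pedge \<Rightarrow> pedge \<Rightarrow> bool" where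
  "external_arrow n D e f \<longleftrightarrow>
     (\<exists>v<n. has_diag D v \<and> e = side_before n v \<and> f = side_after n v)"

definition arrows :: "nat \<Rightarrow> pedge set \<Rightarrow> (pedge \<times> pedge) set" where
  "arrows n D = {(e,f). internal_arrow n D e f \<or> external_arrow n D e f}"

definition qpaths :: "nat \<Rightarrow> pedge set \<Rightarrow> pedge list set" where
  "qpaths n D = {p. p \<noteq> [] \<and> set p \<subseteq> edges n D \<and>
      (\<forall>i. Suc i < length p \<longrightarrow> (p ! i, p ! Suc i) \<in> arrows n D)}"

definition path_alg :: "nat \<Rightarrow> pedge set \<Rightarrow> (pedge list \<Rightarrow> 'k::field) set" where
  "path_alg n D = {f. finite {p. f p \<noteq> 0} \<and> {p. f p \<noteq> 0} \<subseteq> qpaths n D}"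

text \<open>Multiplication: concatenation of paths (p then q), p * q = p @ tl q when last p = hd q.\<close>
definition pmult :: "(pedge list \<Rightarrow> 'k::field) \<Rightarrow> (pedge list \<Rightarrow> 'k) \<Rightarrow> pedge list \<Rightarrow> 'k" where
  "pmult f g p = (\<Sum>i<length p. f (take (Suc i) p) * g (drop i p))"

definition padd :: "(pedge list \<Rightarrow> 'k::field) \<Rightarrow> (pedge list \<Rightarrow> 'k) \<Rightarrow> pedge list \<Rightarrow> 'k" where
  "padd f g p = f p + g p"

definition psmult :: "'k::field \<Rightarrow> (pedge list \<Rightarrow> 'k) \<Rightarrow> pedge list \<Rightarrow> 'k" where
  "psmult c f p = c * f p"

definition pbasis :: "pedge list \<Rightarrow> pedge list \<Rightarrow> 'k::field" where
  "pbasis q p = (if p = q then 1 else 0)"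

definition pone :: "nat \<Rightarrow> pedge set \<Rightarrow> pedge list \<Rightarrow> 'k::field" where
  "pone n D p = (if \<exists>v \<in> edges n D. p = [v] then 1 else 0)"

text \<open>A cycle is given by its list of vertices [v_0,...,v_(d-1)], with arrows v_i -> v_(i+1 mod d).
  The term of the cyclic derivative coming from position i is the path
  v_(i+1), ..., v_(i+d) (indices mod d).\<close>
definition rot_path :: "pedge list \<Rightarrow> nat \<Rightarrow> pedge list" where
  "rot_path cyc i = map (\<lambda>k. cyc ! ((i + 1 + k) mod length cyc)) [0..<length cyc]"

definition cyc_deriv :: "pedge \<times> pedge \<Rightarrow> pedge list \<Rightarrow> pedge list \<Rightarrow> 'k::field" where
  "cyc_deriv a cyc p = of_nat (card {i. i < length cyc \<and>
       (cyc ! i, cyc ! ((i + 1) mod length cyc)) = a \<and> rot_path cyc i = p})"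

definition tri_cycle :: "nat \<times> nat \<times> nat \<Rightarrow> pedge list" where
  "tri_cycle t = (case t of (a,b,c) \<Rightarrow> [(a,b),(a,c),(b,c)])"

text \<open>Big cycle around polygon vertex v: the edges at v in anticlockwise order, from side
  {v,v+1} to side {v-1,v}, closed by the external arrow.\<close>
definition big_cycle :: "nat \<Rightarrow> pedge set \<Rightarrow> nat \<Rightarrow> pedge list" where
  "big_cycle n D v = filter (\<lambda>e. e \<in> edges n D) (map (\<lambda>k. mk_edge v ((v + k) mod n)) [1..<n])"

definition dW :: "nat \<Rightarrow> pedge set \<Rightarrow> pedge \<times> pedge \<Rightarrow> pedge list \<Rightarrow> 'k::field" where
  "dW n D a p = (\<Sum>t\<in>triangles n D. cyc_deriv a (tri_cycle t) p)
               - (\<Sum>v\<in>{v. v < n \<and> has_diag D v}. cyc_deriv a (big_cycle n D v) p)"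

inductive_set jac_ideal :: "nat \<Rightarrow> pedge set \<Rightarrow> (pedge list \<Rightarrow> 'k::field) set"
  for n :: nat and D :: "pedge set" where
  zero: "(\<lambda>_. 0) \<in> jac_ideal n D"
| gen: "a \<in> arrows n D \<Longrightarrow> (fst a \<notin> sides n \<or> snd a \<notin> sides n) \<Longrightarrow>
        p \<in> qpaths n D \<Longrightarrow> q \<in> qpaths n D \<Longrightarrow>
        pmult (pmult (pbasis p) (dW n D a)) (pbasis q) \<in> jac_ideal n D"
| add: "f \<in> jac_ideal n D \<Longrightarrow> g \<in> jac_ideal n D \<Longrightarrow> padd f g \<in> jac_ideal n D"
| smult: "f \<in> jac_ideal n D \<Longrightarrow> psmult c f \<in> jac_ideal n D"

type_synonym 'k rmat = "nat \<Rightarrow> nat \<Rightarrow> 'k poly fract"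

definition fpoly :: "'k::field poly \<Rightarrow> 'k poly fract" where
  "fpoly p = Fract p 1"

definition xpowR :: "int \<Rightarrow> 'k::field poly fract set" where
  "xpowR a = {fpoly p * (fpoly [:0, 1:]) powi a | p. True}"

definition mat_mult :: "nat \<Rightarrow> 'k::field rmat \<Rightarrow> 'k rmat \<Rightarrow> 'k rmat" where
  "mat_mult m A B i j = (if i < m \<and> j < m then (\<Sum>k<m. A i k * B k j) else 0)"

definition mat_one :: "nat \<Rightarrow> 'k::field rmat" where
  "mat_one m i j = (if i < m \<and> j = i then 1 else 0)"

definition mat_add :: "'k::field rmat \<Rightarrow> 'k rmat \<Rightarrow> 'k rmat" where
  "mat_add A B i j = A i j + B i j"

definition mat_scal :: "'k::field \<Rightarrow> 'k rmat \<Rightarrow> 'k rmat" where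
  "mat_scal c A i j = fpoly [:c:] * A i j"

definition tiled_order :: "nat \<Rightarrow> (nat \<Rightarrow> nat \<Rightarrow> int) \<Rightarrow> 'k::field rmat set" where
  "tiled_order m a = {M. \<forall>i j. (i < m \<and> j < m \<longrightarrow> M i j \<in> xpowR (a i j)) \<and>
                              (\<not> (i < m \<and> j < m) \<longrightarrow> M i j = 0)}"

definition tiled_exponents :: "nat \<Rightarrow> (nat \<Rightarrow> nat \<Rightarrow> int) \<Rightarrow> bool" where
  "tiled_exponents m a \<longleftrightarrow> (\<forall>i<m. \<forall>j<m. \<forall>t<m. a i j + a j t \<ge> a i t)"

text \<open>phi : KQ_sigma -> M_m(K(x)) is a unital K-algebra homomorphism with kernel J onto the
  tiled order; it thus induces a K-algebra isomorphism Gamma_sigma = KQ/J ~= tiled order,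
  through which Gamma_sigma acquires its R-algebra structure.\<close>
definition jac_tiled_iso :: "nat \<Rightarrow> pedge set \<Rightarrow> nat \<Rightarrow> (nat \<Rightarrow> nat \<Rightarrow> int)
     \<Rightarrow> ((pedge list \<Rightarrow> 'k::field) \<Rightarrow> 'k rmat) \<Rightarrow> bool" where
  "jac_tiled_iso n D m a phi \<longleftrightarrow>
     (\<forall>f\<in>path_alg n D. \<forall>g\<in>path_alg n D. phi (padd f g) = mat_add (phi f) (phi g)) \<and>
     (\<forall>f\<in>path_alg n D. \<forall>c. phi (psmult c f) = mat_scal c (phi f)) \<and>
     (\<forall>f\<in>path_alg n D. \<forall>g\<in>path_alg n D. phi (pmult f g) = mat_mult m (phi f) (phi g)) \<and>
     phi (pone n D) = mat_one m \<and>
     {f \<in> path_alg n D. phi f = (\<lambda>_ _. 0)} = jac_ideal n D \<and>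
     phi ` path_alg n D = tiled_order m a"

end

theory Submission
  imports Defs
begin

text \<open>Give an internal arrow moving one end of an edge anticlockwise from \<open>p\<close> to \<open>q\<close> the degree
  \<open>(q - p) mod n\<close>, and an external arrow the degree \<open>2\<close>. Every minimal cycle then has degree \<open>n\<close>, and
  up to the coboundary of the sum of the two ends the degree is \<open>n\<close> times the weight that is \<open>1\<close> on
  arrows decreasing this sum and \<open>0\<close> on the others. Sending a path \<open>p\<close> from \<open>e\<close> to \<open>f\<close> to
  \<open>x\<close> to the weight of \<open>p\<close> in position \<open>(e, f)\<close> therefore kills the Jacobian ideal, and the image is
  the tiled order of minimal weights.

  The kernel is the Jacobian ideal provided parallel paths of equal weight agree modulo the
  relations. A path is a sequence of rotations around polygon vertices. By the relation in a triangle, a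
  rotation around \<open>i\<close> followed by one around the new end can be traded for the long rotation around
  the third corner; going through the sides of \<open>P\<close> this way, every path from a fixed edge becomes
  a power of the full turn times one canonical path depending only on the target.\<close>

section \<open>Triangulations with vertices lifted to the integers\<close>

text \<open>The degree \<open>2\<close> of an external arrow is forced: its free end jumps from
  \<open>i - 1\<close> past \<open>i\<close> to \<open>i + 1\<close>, and with the
  \<open>n - 2\<close> of the internal arrows around \<open>i\<close> the big cycle has degree
  \<open>n\<close>, like a triangle. A move by \<open>d < n\<close> passes the residue
  \<open>0\<close> at most once, so an arrow has weight \<open>0\<close> or \<open>1\<close>. A full
  turn has weight \<open>1\<close>, and the full turns at all edges add up to an element sent to
  \<open>x\<close> times the identity matrix: this is the action of \<open>x\<close>. Extracting its
  powers from a path requires that the full turn at an edge does not depend on the end around which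
  it is made. Two obstacles shape the normal form. The start edge cuts the polygon into two parts,
  and the canonical path to a target depends on the part containing it; paths are therefore
  normalised relative to either part, and the two descriptions are reconciled at the start edge,
  where they meet. An ear, a vertex without diagonals, has neither an external arrow nor a relation
  at its corner.\<close>

text \<open>Vertices are integers modulo \<open>n\<close>, so that a cyclic order condition becomes a chain of inequalities
  between lifts within a window of length \<open>n\<close>.\<close>

definition cyc_edge :: "nat \<Rightarrow> int \<Rightarrow> int \<Rightarrow> pedge" where
  "cyc_edge n i j = mk_edge (nat (i mod int n)) (nat (j mod int n))"

locale triangulated_polygon =
  fixes n :: nat and D :: "pedge set"
  assumes n_ge_3: "3 \<le> n" and triangulation: "is_triangulation n D"
begin

abbreviation N :: int where "N \<equiv> int n"

abbreviation E :: "int \<Rightarrow> int \<Rightarrow> pedge" where "E \<equiv> cyc_edge n"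

definition P :: "int \<Rightarrow> int \<Rightarrow> bool" where "P i j \<longleftrightarrow> E i j \<in> edges n D"

lemma N_ge_3: "3 \<le> N"
  using n_ge_3 by simp

lemma E_commute: "E i j = E j i"
  by (simp add: cyc_edge_def mk_edge_def min.commute max.commute)

lemma P_commute: "P i j = P j i"
  by (simp add: P_def E_commute)

lemma E_shift [simp]: "E (i + N) j = E i j" "E i (j + N) = E i j" "E (i - N) j = E i j" "E i (j - N) = E i j"
  by (simp_all add: cyc_edge_def)

lemma P_shift [simp]: "P (i + N) j = P i j" "P i (j + N) = P i j" "P (i - N) j = P i j" "P i (j - N) = P i j"
  by (simp_all add: P_def)

lemma E_mod [simp]: "E (i mod N) j = E i j" "E i (j mod N) = E i j"
  by (simp_all add: cyc_edge_def)

lemma P_mod [simp]: "P (i mod N) j = P i j" "P i (j mod N) = P i j"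
  by (simp_all add: P_def)

lemma E_eq_iff:
  "E i j = E k l \<longleftrightarrow>
     (i mod N = k mod N \<and> j mod N = l mod N) \<or> (i mod N = l mod N \<and> j mod N = k mod N)"
proof -
  have "nat (x mod N) = nat (y mod N) \<longleftrightarrow> x mod N = y mod N" for x y
    using N_ge_3 by (simp add: eq_nat_nat_iff)
  then show ?thesis
    by (auto simp: cyc_edge_def mk_edge_def min_def max_def split: if_splits)
qed

lemma E_of_nat: "a < b \<Longrightarrow> b < n \<Longrightarrow> E (int a) (int b) = (a, b)"
  by (simp add: cyc_edge_def mk_edge_def)

lemma edgesD:
  assumes "e \<in> edges n D"
  shows "fst e < snd e" "snd e < n"
  using assms triangulation
  by (auto simp: edges_def sides_def is_side_def is_triangulation_def is_diag_def)

lemma edge_eq_E: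
  assumes "e \<in> edges n D"
  shows "e = E (int (fst e)) (int (snd e))"
  using E_of_nat edgesD[OF assms] by simp

lemma P_neq: "P i j \<Longrightarrow> i mod N \<noteq> j mod N"
  using edgesD[of "E i j"] by (auto simp: P_def cyc_edge_def mk_edge_def)

lemma mod_window:
  assumes "0 \<le> i" "i < 2 * N"
  shows "i mod N = (if i < N then i else i - N)"
proof (cases "i < N")
  case False
  then have "(i - N) mod N = i - N" using assms by (intro mod_pos_pos_trivial) auto
  then show ?thesis using False by simp
qed (use assms in auto)

lemma is_side_E:
  assumes "i < j" "j < i + N"
  shows "is_side n (E i j) \<longleftrightarrow> j = i + 1 \<or> j = i + N - 1"
proof -
  \<comment> \<open>Subtracting the multiple \<open>c\<close> of \<open>N\<close> brings
    \<open>i\<close> into \<open>[0, N)\<close> and changes no edge; a lift in the window then needs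
    at most one further subtraction of \<open>N\<close>.\<close>
  define c where "c = i - i mod N"
  define i' where "i' = i - c"
  define j' where "j' = j - c"
  have c: "c mod N = 0" by (simp add: c_def)
  have i': "0 \<le> i'" "i' < N" using N_ge_3 by (auto simp: i'_def c_def)
  have j': "i' < j'" "j' < i' + N" using assms by (auto simp: i'_def j'_def)
  have eq: "E i j = E i' j'"
    unfolding E_eq_iff i'_def j'_def using c by (metis diff_zero mod_diff_right_eq)
  have "i' mod N = i'" using i' by simp
  moreover have "j' mod N = (if j' < N then j' else j' - N)"
    using i' j' by (intro mod_window) auto
  ultimately have "is_side n (E i' j') \<longleftrightarrow> j' = i' + 1 \<or> j' = i' + N - 1"
    using i' j' N_ge_3 by (auto simp: is_side_def cyc_edge_def mk_edge_def min_def max_def)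
  then show ?thesis unfolding eq by (auto simp: i'_def j'_def)
qed

lemma P_next [simp]: "P i (i + 1)" "P (i - 1) i" "P (i + 1) i" "P i (i - 1)"
proof -
  have "P i (i + 1)" for i
    using is_side_E[of i "i + 1"] N_ge_3 by (simp add: P_def edges_def sides_def)
  from this[of i] this[of "i - 1"] show "P i (i + 1)" "P (i - 1) i" "P (i + 1) i" "P i (i - 1)"
    by (simp_all add: P_commute)
qed

lemma crosses_E:
  assumes "i < k" "k < j" "j < l" "l < i + N"
  shows "crosses (E i j) (E k l)"
proof -
  define c where "c = i - i mod N"
  have c: "c mod N = 0" by (simp add: c_def)
  have sh: "E x y = E (x - c) (y - c)" for x y
    unfolding E_eq_iff using c by (metis diff_zero mod_diff_right_eq)
  have i: "0 \<le> i - c" "i - c < N" using N_ge_3 by (auto simp: c_def)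
  have m: "x mod N = (if x < N then x else x - N)"
    if "i - c \<le> x" "x < i - c + N" for x
    using i that by (intro mod_window) auto
  show ?thesis
    unfolding sh[of i] sh[of k]
    using assms i m[of "i - c"] m[of "k - c"] m[of "j - c"] m[of "l - c"]
    by (auto simp: cyc_edge_def mk_edge_def crosses_def min_def max_def)
qed

lemma crosses_imp_diag:
  assumes "crosses d e" "d \<in> edges n D" "e \<in> edges n D"
  shows "d \<in> D \<and> e \<in> D"
  using assms edgesD[OF assms(2)] edgesD[OF assms(3)]
  by (auto simp: edges_def sides_def is_side_def crosses_def)

lemma P_noncrossing:
  assumes "P i j" "P k l" "i < k" "k < j" "j < l" "l < i + N"
  shows False
  using crosses_imp_diag[OF crosses_E[OF assms(3-6)]] crosses_E[OF assms(3-6)] assms(1,2) triangulation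
  by (auto simp: P_def is_triangulation_def)

lemma lift_window:
  assumes "0 < N"
  obtains x' where "x' mod N = x mod N" "i \<le> x'" "x' < i + N"
proof -
  have "(i + (x - i) mod N) mod N = x mod N" by (simp add: mod_add_right_eq)
  then show thesis using that[of "i + (x - i) mod N"] assms by simp
qed

text \<open>Maximality read contrapositively: a diagonal missing from \<open>D\<close> is crossed by
  a member of \<open>D\<close>, and lifting that member into the window at \<open>i\<close> puts its
  ends on opposite sides of \<open>j\<close>. The third side of a triangle is found this
  way.\<close>

lemma P_maximal:
  assumes "i < j" "j < i + N" and nocross: "\<And>k l. i < k \<Longrightarrow> k < j \<Longrightarrow> j < l \<Longrightarrow> l < i + N \<Longrightarrow> \<not> P k l"
  shows "P i j"
proof (rule ccontr)
  assume nP: "\<not> P i j"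
  have ne: "i mod N \<noteq> j mod N"
  proof
    assume "i mod N = j mod N"
    then have "N dvd j - i" by (metis mod_eq_dvd_iff)
    then have "N \<le> j - i" using assms by (intro zdvd_imp_le) auto
    then show False using assms by simp
  qed
  have "is_diag n (E i j)"
  proof -
    have "nat (x mod N) < n" for x using N_ge_3 by (simp add: nat_less_iff)
    moreover have "nat (i mod N) \<noteq> nat (j mod N)" using ne N_ge_3 by (simp add: eq_nat_nat_iff)
    ultimately have "fst (E i j) < snd (E i j)" "snd (E i j) < n"
      by (auto simp: cyc_edge_def mk_edge_def min_def max_def)
    then show ?thesis using nP by (auto simp: is_diag_def P_def edges_def sides_def)
  qed
  moreover have "E i j \<notin> D" using nP by (simp add: P_def edges_def)
  moreover have "\<forall>d. is_diag n d \<and> d \<notin> D \<longrightarrow> (\<exists>e\<in>D. crosses d e)"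
    using triangulation by (simp add: is_triangulation_def)
  ultimately obtain e where e: "e \<in> D" "crosses (E i j) e"
    by blast
  have ee: "e \<in> edges n D" using e by (simp add: edges_def)
  obtain k where k: "k mod N = int (fst e) mod N" "i \<le> k" "k < i + N"
    using lift_window N_ge_3 by (metis not_numeral_le_zero not_le order_less_le_trans zero_less_numeral)
  obtain l where l: "l mod N = int (snd e) mod N" "i \<le> l" "l < i + N"
    using lift_window N_ge_3 by (metis not_numeral_le_zero not_le order_less_le_trans zero_less_numeral)
  have ekl: "e = E k l" using edge_eq_E[OF ee] k l by (metis E_mod)
  then have Pkl: "P k l" "P l k" using ee by (auto simp: P_def E_commute)
  define c where "c = i - i mod N"
  have c: "c mod N = 0" by (simp add: c_def)
  have sh: "E x y = E (x - c) (y - c)" for x y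
    unfolding E_eq_iff using c by (metis diff_zero mod_diff_right_eq)
  have i: "0 \<le> i - c" "i - c < N" using N_ge_3 by (auto simp: c_def)
  have m: "x mod N = (if x < N then x else x - N)"
    if "i - c \<le> x" "x < i - c + N" for x
    using i that by (intro mod_window) auto
  have "i < k \<and> k < j \<and> j < l \<or> i < l \<and> l < j \<and> j < k"
    using e(2) unfolding ekl sh[of i] sh[of k]
    using assms(1,2) i k(2,3) l(2,3) m[of "i - c"] m[of "k - c"] m[of "j - c"] m[of "l - c"]
    by (auto simp: cyc_edge_def mk_edge_def crosses_def min_def max_def split: if_splits)
  then show False using nocross k l Pkl by blast
qed

text \<open>The third vertex is the last neighbour of \<open>i\<close> before \<open>k\<close>. An
  edge crossing \<open>{j, k}\<close> has an end strictly between \<open>j\<close> and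
  \<open>k\<close>; its other end makes it cross \<open>{i, k}\<close>, or is \<open>i\<close>,
  against the choice of \<open>j\<close>, or makes it cross \<open>{i, j}\<close>.\<close>

lemma triangle_below:
  assumes "P i k" "i + 1 < k" "k < i + N"
  obtains j where "i < j" "j < k" "P i j" "P j k" "\<And>l. j < l \<Longrightarrow> l < k \<Longrightarrow> \<not> P i l"
proof -
  let ?S = "{j. i < j \<and> j < k \<and> P i j}"
  have "finite ?S" by (rule finite_subset[of _ "{i..k}"]) auto
  moreover have "i + 1 \<in> ?S" using assms by simp
  ultimately have "Max ?S \<in> ?S" "\<forall>l\<in>?S. l \<le> Max ?S"
    using Max_in[of ?S] by (blast, simp)
  then obtain j where j: "i < j" "j < k" "P i j" and mx': "\<forall>l\<in>?S. l \<le> j"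
    by blast
  have mx: "\<not> P i l" if "j < l" "l < k" for l
  proof
    assume "P i l"
    then have "l \<in> ?S" using j(1) that by auto
    then show False using mx' that(1) by force
  qed
  have "P j k"
  proof (rule P_maximal)
    show "j < k" "k < j + N" using j assms by auto
    fix a b assume ab: "j < a" "a < k" "k < b" "b < j + N"
    show "\<not> P a b"
    proof
      assume "P a b"
      consider "b < i + N" | "b = i + N" | "i + N < b" by linarith
      then show False
      proof cases
        case 1
        then show False using P_noncrossing[of i k a b] ab j assms \<open>P a b\<close> by auto
      next
        case 2
        then show False using mx[of a] ab \<open>P a b\<close> by (simp add: P_commute)
      next
        case 3
        then show False
          using P_noncrossing[of a b "i + N" "j + N"] ab j assms \<open>P a b\<close> by auto
      qed
    qed
  qed
  then show thesis using that j mx by blast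
qed

end

section \<open>Path composition and weights\<close>

text \<open>The empty list, which is not a path, plays the role of zero; this makes composition
  associative without side conditions.\<close>

definition pcomp :: "'a list \<Rightarrow> 'a list \<Rightarrow> 'a list" (infixr "\<odot>" 70) where
  "p \<odot> q = (if p = [] \<or> q = [] \<or> last p \<noteq> hd q then [] else p @ tl q)"

lemma pcomp_Nil [simp]: "[] \<odot> q = []" "p \<odot> [] = []"
  by (simp_all add: pcomp_def)

lemma pcomp_eq_Nil: "p \<odot> q = [] \<longleftrightarrow> p = [] \<or> q = [] \<or> last p \<noteq> hd q"
  by (simp add: pcomp_def)

lemma hd_pcomp: "p \<odot> q \<noteq> [] \<Longrightarrow> hd (p \<odot> q) = hd p"
  by (auto simp: pcomp_def split: if_splits)

lemma last_pcomp: "p \<odot> q \<noteq> [] \<Longrightarrow> last (p \<odot> q) = last q"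
  by (cases q; cases "tl q") (auto simp: pcomp_def split: if_splits)

lemma pcomp_assoc: "(p \<odot> q) \<odot> r = p \<odot> q \<odot> r"
proof (cases "p = [] \<or> q = [] \<or> r = [] \<or> last p \<noteq> hd q \<or> last q \<noteq> hd r")
  case True
  then show ?thesis
    using hd_pcomp[of q r] last_pcomp[of p q] by (fastforce simp: pcomp_def)
next
  case False
  then show ?thesis
    using hd_pcomp[of q r] last_pcomp[of p q] by (cases q) (auto simp: pcomp_def)
qed

lemma pcomp_unit_left: "hd p = e \<Longrightarrow> [e] \<odot> p = p"
  by (cases p) (auto simp: pcomp_def)

lemma pcomp_unit_right: "last p = e \<Longrightarrow> p \<odot> [e] = p"
  by (auto simp: pcomp_def)

definition weight :: "pedge \<Rightarrow> pedge \<Rightarrow> nat" where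
  "weight e f = (if fst e + snd e > fst f + snd f then 1 else 0)"

fun path_weight :: "pedge list \<Rightarrow> nat" where
  "path_weight (e # f # p) = weight e f + path_weight (f # p)"
| "path_weight _ = 0"

lemma path_weight_append:
  "p \<noteq> [] \<Longrightarrow> path_weight (p @ q) = path_weight p + path_weight (last p # q)"
  by (induction p rule: path_weight.induct) auto

lemma path_weight_pcomp:
  assumes "p \<odot> q \<noteq> []"
  shows "path_weight (p \<odot> q) = path_weight p + path_weight q"
  using assms by (cases q) (auto simp: pcomp_def path_weight_append split: if_splits)

context triangulated_polygon
begin

abbreviation path :: "pedge list \<Rightarrow> bool" where "path p \<equiv> p \<in> qpaths n D"

lemma path_iff:
  "path p \<longleftrightarrow> p \<noteq> [] \<and> set p \<subseteq> edges n D \<and> successively (\<lambda>e f. (e, f) \<in> arrows n D) p"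
  by (simp add: qpaths_def successively_conv_nth)

lemma path_not_Nil: "path p \<Longrightarrow> p \<noteq> []"
  by (simp add: path_iff)

lemma path_pcomp: "path (p \<odot> q) \<longleftrightarrow> path p \<and> path q \<and> last p = hd q"
proof (cases "p = [] \<or> q = [] \<or> last p \<noteq> hd q")
  case True
  then show ?thesis by (auto simp: path_iff pcomp_def)
next
  case False
  then obtain e q' where "q = e # q'" "p \<noteq> []" "last p = e"
    by (cases q) auto
  moreover from this have "e \<in> set p" by auto
  ultimately show ?thesis
    by (cases q') (auto simp: path_iff pcomp_def successively_append_iff)
qed

lemma path_singleton: "e \<in> edges n D \<Longrightarrow> path [e]"
  by (simp add: path_iff)

section \<open>Triangles and arrows in lifted coordinates\<close>

definition triangle :: "int \<Rightarrow> int \<Rightarrow> int \<Rightarrow> bool" where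
  "triangle i j k \<longleftrightarrow> i < j \<and> j < k \<and> k < i + N \<and> P i j \<and> P j k \<and> P i k"

lemma triangle_rotate: "triangle i j k \<Longrightarrow> triangle j k (i + N)"
  by (auto simp: triangle_def P_commute)

definition diag_at :: "int \<Rightarrow> bool" where
  "diag_at i \<longleftrightarrow> has_diag D (nat (i mod N))"

lemma mod_eq_window: "x mod N = y mod N \<Longrightarrow> \<bar>x - y\<bar> < N \<Longrightarrow> x = y"
  by (metis mod_eq_dvd_iff zdvd_not_zless zero_less_abs_iff dvd_abs_iff right_minus_eq)

lemma mod_add_dvd: "N dvd c \<Longrightarrow> (x + c) mod N = x mod N"
  by (auto elim!: dvdE)

lemma E_shift_dvd: "N dvd c \<Longrightarrow> E (i + c) j = E i j" "N dvd c \<Longrightarrow> E i (j + c) = E i j"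
  by (auto simp: cyc_edge_def elim!: dvdE)

lemma P_shift_dvd: "N dvd c \<Longrightarrow> P (i + c) j = P i j" "N dvd c \<Longrightarrow> P i (j + c) = P i j"
  by (simp_all add: P_def E_shift_dvd)

lemma diag_at_iff: "diag_at i \<longleftrightarrow> (\<exists>j. i + 1 < j \<and> j < i + N - 1 \<and> P i j)"
proof
  assume "diag_at i"
  then obtain d where d: "d \<in> D" "nat (i mod N) \<in> ends d"
    by (auto simp: diag_at_def has_diag_def)
  then have de: "d \<in> edges n D" and ds: "\<not> is_side n d"
    using triangulation by (auto simp: edges_def is_triangulation_def is_diag_def)
  define y where "y = int (other_end d (nat (i mod N)))"
  have "int (nat (i mod N)) = i mod N" using N_ge_3 by simp
  then have "E (i mod N) y = E (int (fst d)) (int (snd d))"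
    using d(2) E_commute[of "int (snd d)"] unfolding ends_def other_end_def y_def
    by (auto simp del: E_mod dest!: sym[of _ "snd d"])
  then have "d = E (i mod N) y" using edge_eq_E[OF de] by simp
  moreover obtain j where j: "j mod N = y mod N" "i \<le> j" "j < i + N"
    using lift_window N_ge_3 by (metis not_numeral_le_zero not_le order_less_le_trans zero_less_numeral)
  ultimately have dj: "d = E i j" by (metis E_mod)
  then have P: "P i j" using de by (simp add: P_def)
  then have "i < j" using P_neq j by (cases "i = j") auto
  then show "\<exists>j. i + 1 < j \<and> j < i + N - 1 \<and> P i j"
    using is_side_E[of i j] ds j P unfolding dj by (intro exI[of _ j]) auto
next
  assume "\<exists>j. i + 1 < j \<and> j < i + N - 1 \<and> P i j"
  then obtain j where j: "i + 1 < j" "j < i + N - 1" "P i j" by blast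
  then have "E i j \<in> D" using is_side_E[of i j] by (auto simp: P_def edges_def sides_def)
  moreover have "nat (i mod N) \<in> ends (E i j)"
    by (auto simp: ends_def cyc_edge_def mk_edge_def min_def max_def)
  ultimately show "diag_at i" by (auto simp: diag_at_def has_diag_def)
qed

text \<open>Reduction modulo \<open>N\<close> preserves the cyclic order of lifts within a window,
  so only a rotation separates them from a sorted triple. One lifted statement can thus stand for
  all three corners.\<close>

lemma triangle_sorted:
  assumes "triangle i j k"
  obtains a b c where "is_triangle n D a b c"
    "(i mod N, j mod N, k mod N) \<in>
      {(int a, int b, int c), (int b, int c, int a), (int c, int a, int b)}"
proof -
  define s where "s = i - i mod N"
  have "N dvd s" by (simp add: s_def)
  then have dvd: "N dvd - s" by simp
  have m: "x mod N = (if x - s < N then x - s else x - s - N)" if "i \<le> x" "x < i + N" for x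
  proof -
    have "(x - s) mod N = (if x - s < N then x - s else x - s - N)"
      using that N_ge_3 pos_mod_bound[of N i] pos_mod_sign[of N i]
      unfolding s_def by (intro mod_window) linarith+
    moreover have "(x - s) mod N = x mod N"
      by (metis \<open>N dvd s\<close> diff_zero dvd_imp_mod_0 mod_diff_right_eq)
    ultimately show ?thesis by simp
  qed
  have ijk: "i < j" "j < k" "k < i + N" "P i j" "P j k" "P i k"
    using assms by (auto simp: triangle_def)
  have *: "is_triangle n D (nat x) (nat y) (nat z)"
    if "0 \<le> x" "x < y" "y < z" "z < N" "P x y" "P y z" "P x z" for x y z
    using that E_of_nat[of "nat x" "nat y"] E_of_nat[of "nat y" "nat z"] E_of_nat[of "nat x" "nat z"]
    by (auto simp: is_triangle_def P_def nat_less_iff)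
  have s: "0 \<le> i - s" "i - s < N" using N_ge_3 by (auto simp: s_def)
  define x where "x = i mod N"
  define y where "y = j mod N"
  define z where "z = k mod N"
  have xyz: "0 \<le> x" "0 \<le> y" "0 \<le> z" "x < N" "y < N" "z < N"
    using N_ge_3 by (auto simp: x_def y_def z_def)
  have PP: "P x y" "P y z" "P x z" "P y x" "P z y" "P z x"
    using ijk by (simp_all add: x_def y_def z_def P_commute)
  have "x < y \<and> y < z \<or> y < z \<and> z < x \<or> z < x \<and> x < y"
    using m[of i] m[of j] m[of k] ijk(1-3) s unfolding x_def y_def z_def by (auto split: if_splits)
  then show thesis
  proof (elim disjE)
    assume "x < y \<and> y < z"
    then show thesis using that[of "nat x" "nat y" "nat z"] * xyz PP
      by (simp add: x_def[symmetric] y_def[symmetric] z_def[symmetric])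
  next
    assume "y < z \<and> z < x"
    then show thesis using that[of "nat y" "nat z" "nat x"] * xyz PP
      by (simp add: x_def[symmetric] y_def[symmetric] z_def[symmetric])
  next
    assume "z < x \<and> x < y"
    then show thesis using that[of "nat z" "nat x" "nat y"] * xyz PP
      by (simp add: x_def[symmetric] y_def[symmetric] z_def[symmetric])
  qed
qed

lemma is_triangle_lift:
  assumes "is_triangle n D a b c"
  shows "triangle (int a) (int b) (int c)"
  using assms E_of_nat by (auto simp: is_triangle_def triangle_def P_def)

lemma triangle_internal_arrow:
  assumes "triangle i j k"
  shows "internal_arrow n D (E i j) (E i k)"
proof -
  obtain a b c where t: "is_triangle n D a b c" and
    m: "(i mod N, j mod N, k mod N) \<in>
      {(int a, int b, int c), (int b, int c, int a), (int c, int a, int b)}"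
    using triangle_sorted[OF assms] .
  have abc: "a < b" "b < c" "c < n" using t by (auto simp: is_triangle_def)
  have E: "E (int a) (int b) = (a, b)" "E (int b) (int c) = (b, c)" "E (int a) (int c) = (a, c)"
    using abc E_of_nat by auto
  have 1: "internal_arrow n D (a, b) (a, c)"
    unfolding internal_arrow_def
    by (rule exI[of _ a], rule exI[of _ b], rule exI[of _ c], intro conjI exI[of _ a])
       (use t abc in \<open>auto simp: ends_def other_end_def ccw_dist_def mod_if\<close>)
  have 2: "internal_arrow n D (b, c) (a, b)"
    unfolding internal_arrow_def
    by (rule exI[of _ a], rule exI[of _ b], rule exI[of _ c], intro conjI exI[of _ b])
       (use t abc in \<open>auto simp: ends_def other_end_def ccw_dist_def mod_if\<close>)
  have 3: "internal_arrow n D (a, c) (b, c)"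
    unfolding internal_arrow_def
    by (rule exI[of _ a], rule exI[of _ b], rule exI[of _ c], intro conjI exI[of _ c])
       (use t abc in \<open>auto simp: ends_def other_end_def ccw_dist_def mod_if\<close>)
  have "(E i j, E i k) = (E (i mod N) (j mod N), E (i mod N) (k mod N))" by simp
  also have "\<dots> \<in> {((a, b), (a, c)), ((b, c), (a, b)), ((a, c), (b, c))}"
    using m E by (auto simp: E_commute simp del: E_mod)
  finally show ?thesis using 1 2 3 by auto
qed

lemma internal_arrowE:
  assumes "internal_arrow n D e f"
  obtains i j k where "triangle i j k" "e = E i j" "f = E i k"
proof -
  obtain a b c v where t: "is_triangle n D a b c" "e \<in> {(a,b),(b,c),(a,c)}" "f \<in> {(a,b),(b,c),(a,c)}"
    "e \<noteq> f" "v \<in> ends e" "v \<in> ends f" "ccw_dist n v (other_end e v) < ccw_dist n v (other_end f v)"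
    using assms unfolding internal_arrow_def by blast
  have abc: "a < b" "b < c" "c < n" using t by (auto simp: is_triangle_def)
  have E: "(a, b) = E (int a) (int b)" "(b, c) = E (int b) (int c)" "(a, c) = E (int a) (int c)"
    using abc E_of_nat by auto
  note tr = is_triangle_lift[OF t(1)]
  have d: "ccw_dist n x y = (if x \<le> y then y - x else y + n - x)" if "x < n" "y < n" for x y
    using that by (auto simp: ccw_dist_def mod_if)
  have "(e, f) \<in> {((a, b), (a, c)), ((b, c), (a, b)), ((a, c), (b, c))}"
    using t(2-7) abc
    by (elim insertE emptyE; simp; hypsubst?; auto simp: ends_def other_end_def d)
  then consider "e = E a b" "f = E a c" | "e = E b c" "f = E b (a + N)" | "e = E c (a + N)" "f = E c (b + N)"
    using E by (auto simp: E_commute)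
  then show thesis
    using that tr triangle_rotate[OF tr] triangle_rotate[OF triangle_rotate[OF tr]] by metis
qed

lemma side_before_eq: "v < n \<Longrightarrow> side_before n v = E (int v - 1) (int v)"
proof -
  assume v: "v < n"
  have "int ((v + n - 1) mod n) = (int v - 1 + N) mod N"
    using v by (simp add: zmod_int of_nat_diff algebra_simps)
  then have "nat ((int v - 1) mod N) = (v + n - 1) mod n" by (metis mod_add_self2 nat_int)
  then show ?thesis using v by (simp add: side_before_def cyc_edge_def)
qed

lemma side_after_eq: "v < n \<Longrightarrow> side_after n v = E (int v) (int v + 1)"
proof -
  assume v: "v < n"
  have "int ((v + 1) mod n) = (int v + 1) mod N"
    by (simp add: zmod_int algebra_simps)
  then have "nat ((int v + 1) mod N) = (v + 1) mod n" by (metis nat_int)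
  then show ?thesis using v by (simp add: side_after_def cyc_edge_def)
qed

lemma external_arrow_iff:
  "external_arrow n D e f \<longleftrightarrow> (\<exists>i. diag_at i \<and> e = E (i - 1) i \<and> f = E i (i + 1))"
proof
  assume "external_arrow n D e f"
  then obtain v where v: "v < n" "has_diag D v" "e = side_before n v" "f = side_after n v"
    by (auto simp: external_arrow_def)
  then show "\<exists>i. diag_at i \<and> e = E (i - 1) i \<and> f = E i (i + 1)"
    by (intro exI[of _ "int v"]) (simp add: diag_at_def side_before_eq side_after_eq)
next
  assume "\<exists>i. diag_at i \<and> e = E (i - 1) i \<and> f = E i (i + 1)"
  then obtain i where i: "diag_at i" "e = E (i - 1) i" "f = E i (i + 1)" by blast
  define v where "v = nat (i mod N)"
  have v: "int v = i mod N" "v < n"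
    using N_ge_3 by (simp_all add: v_def nat_less_iff)
  have "e = E (int v - 1) (int v)" "f = E (int v) (int v + 1)"
    unfolding i v E_eq_iff by (simp_all add: mod_diff_left_eq mod_add_left_eq)
  then show "external_arrow n D e f"
    using v i(1) unfolding external_arrow_def diag_at_def v_def[symmetric]
    by (intro exI[of _ v]) (simp add: side_before_eq side_after_eq)
qed

text \<open>An arrow fixes one end and advances the other: \<open>fst\<close> and \<open>snd\<close>
  say whether \<open>i\<close> or \<open>j\<close> is the fixed end of an internal arrow. An
  external arrow leaves a side, and turns around its later end. The lifts in the definitions differ
  from \<open>i\<close> and \<open>j\<close> by multiples of \<open>N\<close>, which the window
  determines.\<close>

lemma arrow_cases:
  assumes "(E i j, g) \<in> arrows n D" "i < j" "j < i + N"
  obtains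
    (fst) k where "triangle i j k" "g = E i k"
  | (snd) k where "triangle i k j" "g = E j k"
  | (ext_fst) "j = i + N - 1" "diag_at i" "g = E i (i + 1)"
  | (ext_snd) "j = i + 1" "diag_at j" "g = E j (j + 1)"
proof -
  have sh: "N dvd c \<Longrightarrow> triangle (a + c) (b + c) (d + c) = triangle a b d" for a b c d
    by (simp add: triangle_def P_shift_dvd)
  consider "internal_arrow n D (E i j) g" | "external_arrow n D (E i j) g"
    using assms by (auto simp: arrows_def)
  then show thesis
  proof cases
    case 1
    then obtain a b d where abd: "triangle a b d" "E i j = E a b" "g = E a d"
      using internal_arrowE by metis
    then have w: "a < b" "b < d" "d < a + N" by (auto simp: triangle_def)
    consider "i mod N = a mod N" "j mod N = b mod N" | "i mod N = b mod N" "j mod N = a mod N"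
      using abd(2) by (auto simp: E_eq_iff)
    then show thesis
    proof cases
      case 1
      then have dvd: "N dvd i - a" by (metis mod_eq_dvd_iff)
      have "j mod N = (b + (i - a)) mod N"
        using 1 mod_add_dvd[OF dvd] by simp
      then have "j = b + (i - a)" using w assms(2,3) by (elim mod_eq_window) linarith
      then have "triangle i j (d + (i - a))" "g = E i (d + (i - a))"
        using sh[OF dvd, of a b d] abd(1,3) E_shift_dvd(1)[OF dvd, of a "d + (i - a)"]
          E_shift_dvd(2)[OF dvd, of a d] by simp_all
      then show thesis using that(1) by blast
    next
      case 2
      then have dvd: "N dvd j - a" by (metis mod_eq_dvd_iff)
      have "(i + N) mod N = (b + (j - a)) mod N"
        using 2 mod_add_dvd[OF dvd] by simp
      then have i: "i + N = b + (j - a)" using w assms(2,3) by (elim mod_eq_window) linarith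
      define k where "k = d + (j - a) - N"
      have "triangle j (i + N) (k + N)" "g = E j (k + N)"
        using sh[OF dvd, of a b d] abd(1,3) E_shift_dvd(1)[OF dvd, of a "d + (j - a)"]
          E_shift_dvd(2)[OF dvd, of a d] unfolding i k_def by simp_all
      then have "triangle i k j" "g = E j k" by (auto simp: triangle_def P_commute)
      then show thesis using that(2) by blast
    qed
  next
    case 2
    then obtain a where a: "diag_at a" "E i j = E (a - 1) a" "g = E a (a + 1)"
      by (auto simp: external_arrow_iff)
    consider "i mod N = (a - 1) mod N" "j mod N = a mod N" | "i mod N = a mod N" "j mod N = (a - 1) mod N"
      using a(2) by (auto simp: E_eq_iff)
    then show thesis
    proof cases
      case 1
      then have "j mod N = (i + 1) mod N" by (metis diff_add_cancel mod_add_left_eq)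
      then have "j = i + 1" using assms(2,3) N_ge_3 by (elim mod_eq_window) linarith
      moreover have "diag_at j" using 1 a by (simp add: diag_at_def)
      moreover have "g = E j (j + 1)" unfolding a(3) E_eq_iff using 1 by (metis mod_add_left_eq)
      ultimately show thesis using that(4) by blast
    next
      case 2
      then have "j mod N = (i + N - 1) mod N"
        by (metis add_diff_eq add.commute mod_add_self2 mod_diff_left_eq)
      then have "j = i + N - 1" using assms(2,3) N_ge_3 by (elim mod_eq_window) linarith
      moreover have "diag_at i" using 2 a by (simp add: diag_at_def)
      moreover have "g = E i (i + 1)" unfolding a(3) E_eq_iff using 2 by (metis mod_add_left_eq)
      ultimately show thesis using that(3) by blast
    qed
  qed
qed


lemma E_shift_offset [simp]:
  "E (i + N - 1) j = E (i - 1) j" "E j (i + N - 1) = E j (i - 1)"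
  "E (i + N + 1) j = E (i + 1) j" "E j (i + N + 1) = E j (i + 1)"
  using E_shift(1)[of "i - 1" j] E_shift(2)[of j "i - 1"] E_shift(1)[of "i + 1" j] E_shift(2)[of j "i + 1"]
  by (simp_all add: algebra_simps)

lemma P_shift_offset [simp]:
  "P (i + N - 1) j = P (i - 1) j" "P j (i + N - 1) = P j (i - 1)"
  "P (i + N + 1) j = P (i + 1) j" "P j (i + N + 1) = P j (i + 1)"
  by (simp_all add: P_def)

lemma triangle_consecutive_fst:
  assumes "triangle i j k" "j < l" "l < k"
  shows "\<not> P i l"
  using assms P_noncrossing[of i l j k] by (auto simp: triangle_def)

lemma triangle_consecutive_snd:
  assumes "triangle i l k" "i + N < m" "m < l + N"
  shows "\<not> P k m"
proof
  assume "P k m"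
  then have "P (m - N) k" by (simp add: P_commute)
  then show False
    using assms P_noncrossing[of i l "m - N" k] by (auto simp: triangle_def)
qed

text \<open>The induction step for rotations: consecutive neighbours \<open>l < k\<close> of
  \<open>i\<close> bound a triangle, which contains the last arrow of a rotation around
  \<open>i\<close> ending at \<open>{i, k}\<close>.\<close>

lemma previous_neighbour:
  assumes "P i j" "P i k" "i < j" "j < k" "k < i + N"
  obtains l where "j \<le> l" "triangle i l k"
proof -
  obtain l where l: "i < l" "l < k" "P i l" "P l k" "\<And>m. l < m \<Longrightarrow> m < k \<Longrightarrow> \<not> P i m"
    using triangle_below[of i k] assms by auto
  then have "j \<le> l" using assms by (meson not_le)
  then show thesis using that l assms by (auto simp: triangle_def)
qed

lemma diag_at_triangle:
  assumes "triangle i j k" "diag_at i"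
  shows "i + 1 < j \<or> k < i + N - 1"
proof (rule ccontr)
  assume *: "\<not> ?thesis"
  obtain l where l: "i + 1 < l" "l < i + N - 1" "P i l" using assms(2) diag_at_iff by blast
  moreover have "j = i + 1" "k = i + N - 1" using assms(1) * by (auto simp: triangle_def)
  ultimately show False using triangle_consecutive_fst[OF assms(1), of l] by auto
qed

lemma not_diag_at_triangle:
  assumes "triangle i j k" "\<not> diag_at i"
  shows "j = i + 1" "k = i + N - 1"
  using assms unfolding triangle_def diag_at_iff by (force, force)

text \<open>The side \<open>{i, i + 1}\<close> lies in a triangle whose third vertex is a neighbour
  of \<open>i\<close>; without diagonals at \<open>i\<close> this can only be \<open>i - 1\<close>.
  For \<open>n = 3\<close> the resulting edge is itself a side.\<close>

lemma ear_P:
  assumes "\<not> diag_at i"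
  shows "P (i - 1) (i + 1)"
proof -
  have "P (i + 1) (i + N)" by (metis P_next(3) P_shift(2))
  then obtain k where k: "i + 1 < k" "k < i + N" "P (i + 1) k" "P k (i + N)"
    using triangle_below[of "i + 1" "i + N"] N_ge_3 by auto
  then have "k = i + N - 1" using assms by (force simp: diag_at_iff P_commute)
  then have "P (i + 1) (i + N - 1)" using k by blast
  then show ?thesis by (simp add: P_commute)
qed

lemma diag_at_shift [simp]: "diag_at (i + N) = diag_at i"
  by (simp add: diag_at_def)

section \<open>Rotations of an edge around a vertex\<close>

text \<open>\<open>R i j k\<close> rotates the edge \<open>{i, j}\<close> around \<open>i\<close> to \<open>{i, k}\<close>, and \<open>X i\<close> leads from the side before \<open>i\<close>
  to the side after \<open>i\<close>. An ear \<open>i\<close> has no external arrow, so there \<open>X i\<close> is the path of the same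
  degree through the third edge of its triangle. A full turn \<open>T i j\<close> around \<open>i\<close> splits into the part \<open>U i j\<close> up to
  the side \<open>{i, i + 1}\<close> and the part \<open>V i j\<close> from there on; \<open>XX i j\<close> runs along the sides of the polygon.\<close>

definition R :: "int \<Rightarrow> int \<Rightarrow> int \<Rightarrow> pedge list" where
  "R i j k = map (E i) (filter (P i) [j..k])"

definition X :: "int \<Rightarrow> pedge list" where
  "X i = (if diag_at i then [E (i - 1) i, E i (i + 1)] else [E (i - 1) i, E (i - 1) (i + 1), E i (i + 1)])"

definition U :: "int \<Rightarrow> int \<Rightarrow> pedge list" where
  "U i j = R i j (i + N - 1) \<odot> X i"

definition V :: "int \<Rightarrow> int \<Rightarrow> pedge list" where
  "V i j = R i (i + 1) j"

definition T :: "int \<Rightarrow> int \<Rightarrow> pedge list" where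
  "T i j = U i j \<odot> V i j"

fun XX_nat :: "int \<Rightarrow> nat \<Rightarrow> pedge list" where
  "XX_nat i 0 = [E i (i + 1)]"
| "XX_nat i (Suc m) = XX_nat i m \<odot> X (i + int m + 1)"

definition XX :: "int \<Rightarrow> int \<Rightarrow> pedge list" where
  "XX i j = XX_nat i (nat (j - i))"

lemma R_shift [simp]: "R (i + N) j k = R i j k"
proof -
  have "P (i + N) = P i" by (rule ext) simp
  then show ?thesis by (simp add: R_def)
qed

lemma upto_shift: "[j + c..k + c] = map (\<lambda>x. x + c) [j..k::int]"
proof (induction "nat (k - j + 1)" arbitrary: k)
  case 0
  then show ?case by simp
next
  case (Suc m)
  then have "j \<le> k" by simp
  have "[j + c..k + c] = [j + c..k + c - 1] @ [k + c]"
    using \<open>j \<le> k\<close> by (simp add: upto_rec2)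
  also have "k + c - 1 = (k - 1) + c" by simp
  also have "[j + c..(k - 1) + c] = map (\<lambda>x. x + c) [j..k - 1]"
    using Suc by (intro Suc.hyps(1)) simp
  finally show ?case using \<open>j \<le> k\<close> by (simp add: upto_rec2)
qed

lemma R_shift2 [simp]: "R i (j + N) (k + N) = R i j k"
  by (simp add: R_def upto_shift filter_map o_def)

lemma R_not_Nil: "P i k \<Longrightarrow> j \<le> k \<Longrightarrow> R i j k \<noteq> []"
  by (auto simp: R_def filter_empty_conv)

lemma hd_R: "P i j \<Longrightarrow> j \<le> k \<Longrightarrow> hd (R i j k) = E i j"
  by (simp add: R_def upto_rec1)

lemma last_R: "P i k \<Longrightarrow> j \<le> k \<Longrightarrow> last (R i j k) = E i k"
  by (simp add: R_def upto_rec2)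

lemma R_refl: "P i j \<Longrightarrow> R i j j = [E i j]"
  by (simp add: R_def)

lemma R_split:
  assumes "P i k" "j \<le> k" "k \<le> l"
  shows "R i j l = R i j k \<odot> R i k l"
proof -
  have "[j..l] = [j..k] @ [k + 1..l]"
    using assms by (intro upto_split2) auto
  moreover have "[k..l] = k # [k + 1..l]" using assms by (simp add: upto_rec1)
  ultimately have 1: "R i j l = R i j k @ R i (k + 1) l" and 2: "R i k l = E i k # R i (k + 1) l"
    using assms by (simp_all add: R_def)
  show ?thesis unfolding pcomp_def 2 using R_not_Nil last_R assms 1 by simp
qed

lemma R_step:
  assumes "P i l" "P i k" "l < k" "\<And>m. l < m \<Longrightarrow> m < k \<Longrightarrow> \<not> P i m"
  shows "R i l k = [E i l, E i k]"
proof -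
  have 1: "[l..k] = l # [l + 1..k]"
    by (rule upto_rec1) (use assms(3) in linarith)
  have 2: "[l + 1..k] = [l + 1..k - 1] @ [k]"
    by (rule upto_rec2) (use assms(3) in linarith)
  have "\<forall>m\<in>set [l + 1..k - 1]. \<not> P i m"
    using assms(4) by auto
  then have "filter (P i) [l + 1..k - 1] = []"
    by (simp only: filter_empty_conv)
  then show ?thesis
    unfolding R_def 1 2 using assms(1,2) by simp
qed

lemma R_step_fst:
  assumes "triangle i l k"
  shows "R i l k = [E i l, E i k]"
  using assms by (intro R_step triangle_consecutive_fst[OF assms]) (simp_all add: triangle_def)

lemma R_step_snd:
  assumes "triangle i l k"
  shows "R k (i + N) (l + N) = [E i k, E l k]"
proof -
  have "R k (i + N) (l + N) = [E k (i + N), E k (l + N)]"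
    using triangle_consecutive_snd[OF assms] assms P_commute
    by (intro R_step) (auto simp: triangle_def)
  then show ?thesis by (simp add: E_commute)
qed

lemma arrow_fst: "triangle i j k \<Longrightarrow> (E i j, E i k) \<in> arrows n D"
  by (simp add: arrows_def triangle_internal_arrow)

lemma arrow_mid: "triangle i j k \<Longrightarrow> (E j k, E i j) \<in> arrows n D"
  using arrow_fst[OF triangle_rotate, of i j k] by (simp add: E_commute)

lemma arrow_snd: "triangle i j k \<Longrightarrow> (E i k, E j k) \<in> arrows n D"
  using arrow_fst[OF triangle_rotate[OF triangle_rotate], of i j k] by (simp add: E_commute)

lemma path_R:
  assumes "P i j" "P i k" "i < j" "j \<le> k" "k < i + N"
  shows "path (R i j k)"
  using assms
proof (induction "nat (k - j)" arbitrary: k rule: less_induct)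
  case less
  show ?case
  proof (cases "j = k")
    case True
    then show ?thesis using less by (simp add: R_refl path_singleton P_def)
  next
    case False
    then obtain l where l: "j \<le> l" "triangle i l k"
      using previous_neighbour[of i j k] less.prems by auto
    then have t: "l < k" "P i l" by (auto simp: triangle_def)
    have "path (R i j l)" using less l t by (intro less.hyps) auto
    moreover have "path [E i l, E i k]"
      using arrow_fst[OF l(2)] less.prems t by (simp add: path_iff P_def)
    ultimately show ?thesis
      using R_split[of i l j k] l t last_R[of i l j] by (simp add: path_pcomp R_step_fst)
  qed
qed

lemma X_simps [simp]: "X i \<noteq> []" "hd (X i) = E (i - 1) i" "last (X i) = E i (i + 1)"
  by (simp_all add: X_def)

lemma X_shift [simp]: "X (i + N) = X i"
  by (simp add: X_def)

lemma path_X: "path (X i)"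
proof (cases "diag_at i")
  case True
  then have "(E (i - 1) i, E i (i + 1)) \<in> arrows n D"
    using external_arrow_iff by (auto simp: arrows_def)
  then show ?thesis
    using True P_next[of i] by (simp add: X_def path_iff P_def)
next
  case False
  have t: "triangle (i - 1) i (i + 1)"
    using ear_P[OF False] P_next[of i] N_ge_3 by (simp add: triangle_def)
  show ?thesis
    using arrow_fst[OF t] arrow_snd[OF t] False P_next[of i] ear_P[OF False]
    by (simp add: X_def path_iff P_def)
qed

lemma path_U:
  assumes "P i j" "i < j" "j < i + N"
  shows "path (U i j)" "hd (U i j) = E i j" "last (U i j) = E i (i + 1)" "U i j \<noteq> []"
proof -
  have p: "P i (i + N - 1)" using P_next(4)[of i] by (metis P_shift(2) diff_add_eq)
  have e: "E i (i + N - 1) = E (i - 1) i" by (metis E_commute E_shift(2) diff_add_eq)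
  show a: "path (U i j)"
    unfolding U_def path_pcomp using path_R[OF assms(1) p] path_X assms last_R[OF p] e by simp
  then show "U i j \<noteq> []" by (simp add: path_not_Nil)
  then show "hd (U i j) = E i j" "last (U i j) = E i (i + 1)"
    using assms hd_R[OF assms(1)] by (simp_all add: U_def hd_pcomp last_pcomp)
qed

lemma path_V:
  assumes "P i j" "i < j" "j < i + N"
  shows "path (V i j)" "hd (V i j) = E i (i + 1)" "last (V i j) = E i j" "V i j \<noteq> []"
  using assms path_R[of i "i + 1" j] hd_R[of i "i + 1" j] last_R[of i j "i + 1"] R_not_Nil[of i j "i + 1"]
  by (simp_all add: V_def)

lemma U_shift [simp]: "U (i + N) (j + N) = U i j"
  using R_shift2[of i j "i + N - 1"] by (simp add: U_def algebra_simps)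

lemma V_shift [simp]: "V (i + N) (j + N) = V i j"
  using R_shift2[of i "i + 1" j] by (simp add: V_def algebra_simps)

lemma T_shift [simp]: "T (i + N) (j + N) = T i j"
  by (simp add: T_def)

lemma XX_refl [simp]: "XX i i = [E i (i + 1)]"
  by (simp add: XX_def)

lemma XX_Suc:
  assumes "i \<le> j"
  shows "XX i (j + 1) = XX i j \<odot> X (j + 1)"
proof -
  have "nat (j + 1 - i) = Suc (nat (j - i))" "i + int (nat (j - i)) + 1 = j + 1"
    using assms by simp_all
  then show ?thesis by (simp add: XX_def)
qed

lemma path_XX:
  assumes "i \<le> j"
  shows "path (XX i j)" "hd (XX i j) = E i (i + 1)" "last (XX i j) = E j (j + 1)" "XX i j \<noteq> []"
proof -
  have "path (XX i j) \<and> hd (XX i j) = E i (i + 1) \<and> last (XX i j) = E j (j + 1)"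
    using assms
  proof (induction rule: int_ge_induct)
    case base
    then show ?case using P_next by (simp add: path_singleton P_def)
  next
    case (step j)
    then have p: "path (XX i (j + 1))"
      using path_X[of "j + 1"] by (simp add: XX_Suc path_pcomp)
    then have "XX i j \<odot> X (j + 1) \<noteq> []" using step by (simp add: path_not_Nil flip: XX_Suc)
    then show ?case using p step by (simp add: XX_Suc hd_pcomp last_pcomp)
  qed
  then show "path (XX i j)" "hd (XX i j) = E i (i + 1)" "last (XX i j) = E j (j + 1)" "XX i j \<noteq> []"
    by (auto simp: path_not_Nil)
qed

lemma XX_single: "XX i (i + 1) = X (i + 1)"
  by (simp add: XX_Suc pcomp_unit_left)

lemma XX_append:
  assumes "j \<le> k" "i \<le> j"
  shows "XX i k = XX i j \<odot> XX j k"
  using assms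
proof (induction rule: int_ge_induct)
  case base
  then show ?case by (simp add: pcomp_unit_right path_XX)
next
  case (step k)
  then show ?case by (simp add: XX_Suc pcomp_assoc)
qed

section \<open>Degrees and weights of rotations\<close>

definition height :: "pedge \<Rightarrow> int" where
  "height e = int (fst e) + int (snd e)"

lemma height_E: "height (E i j) = i mod N + j mod N"
  using N_ge_3 by (simp add: height_def cyc_edge_def mk_edge_def min_def max_def)

lemma weight_height: "weight e f = (if height f < height e then 1 else 0)"
  by (simp add: weight_def height_def flip: of_nat_add)

text \<open>Moving one end of an edge anticlockwise by \<open>d < n\<close> vertices has degree \<open>d\<close>; up to the
  coboundary \<open>height\<close> this is \<open>n\<close> times the weight.\<close>
lemma weight_rotate:
  assumes "j < k" "k < j + N"
  shows "N * int (weight (E i j) (E i k)) = (k - j) + height (E i j) - height (E i k)"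
proof -
  have "(j + (k - j)) mod N = (j mod N + (k - j)) mod N" by (simp add: mod_add_left_eq)
  also have "\<dots> = (if j mod N + (k - j) < N then j mod N + (k - j) else j mod N + (k - j) - N)"
    using assms N_ge_3 pos_mod_sign[of N j] pos_mod_bound[of N j] by (intro mod_window) linarith+
  finally show ?thesis
    using assms pos_mod_sign[of N j] pos_mod_bound[of N j]
    by (simp add: weight_height height_E)
qed

lemma path_weight_R:
  assumes "P i j" "P i k" "i < j" "j \<le> k" "k < i + N"
  shows "N * int (path_weight (R i j k)) = (k - j) + height (E i j) - height (E i k)"
  using assms
proof (induction "nat (k - j)" arbitrary: k rule: less_induct)
  case less
  show ?case
  proof (cases "j = k")
    case True
    then show ?thesis using less by (simp add: R_refl)
  next
    case False
    then obtain l where l: "j \<le> l" "triangle i l k"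
      using previous_neighbour[of i j k] less.prems by auto
    then have t: "l < k" "P i l" by (auto simp: triangle_def)
    have IH: "N * int (path_weight (R i j l)) = (l - j) + height (E i j) - height (E i l)"
      using less l t by (intro less.hyps) auto
    have "R i j k = R i j l \<odot> [E i l, E i k]"
      using R_split[of i l j k] l t by (simp add: R_step_fst)
    moreover have "R i j k \<noteq> []" using R_not_Nil less.prems by blast
    ultimately have "path_weight (R i j k) = path_weight (R i j l) + weight (E i l) (E i k)"
      by (simp add: path_weight_pcomp)
    then show ?thesis
      using IH weight_rotate[of l k i] t less.prems l by (simp add: algebra_simps)
  qed
qed

text \<open>The degree is \<open>2\<close> in both shapes: the external arrow moves the free end by
  two vertices, and the detour at an ear consists of two moves by one.\<close>

lemma path_weight_X:
  "N * int (path_weight (X i)) = 2 + height (E (i - 1) i) - height (E i (i + 1))"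
proof (cases "diag_at i")
  case True
  then show ?thesis using weight_rotate[of "i - 1" "i + 1" i] N_ge_3 by (simp add: X_def E_commute)
next
  case False
  then show ?thesis
    using weight_rotate[of "i - 1" i "i + 1"] weight_rotate[of i "i + 1" "i - 1"] N_ge_3
    by (simp add: X_def E_commute algebra_simps)
qed

lemma path_weight_U:
  assumes "P i j" "i < j" "j < i + N"
  shows "N * int (path_weight (U i j)) = (i + N + 1 - j) + height (E i j) - height (E i (i + 1))"
proof -
  have p: "P i (i + N - 1)" using P_next(4)[of i] by (metis P_shift(2) diff_add_eq)
  have e: "E i (i + N - 1) = E (i - 1) i" by (metis E_commute E_shift(2) diff_add_eq)
  have "path_weight (U i j) = path_weight (R i j (i + N - 1)) + path_weight (X i)"
    using path_U(4)[OF assms] unfolding U_def by (rule path_weight_pcomp)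
  then show ?thesis
    using path_weight_R[OF assms(1) p] path_weight_X[of i] assms e by (simp add: algebra_simps)
qed

lemma path_weight_V:
  assumes "P i j" "i < j" "j < i + N"
  shows "N * int (path_weight (V i j)) = (j - i - 1) + height (E i (i + 1)) - height (E i j)"
  using path_weight_R[of i "i + 1" j] assms by (simp add: V_def)

lemma path_T:
  assumes "P i j" "i < j" "j < i + N"
  shows "path (T i j)" "hd (T i j) = E i j" "last (T i j) = E i j" "T i j \<noteq> []"
proof -
  show p: "path (T i j)" using path_U[OF assms] path_V[OF assms] by (simp add: T_def path_pcomp)
  then show "T i j \<noteq> []" by (rule path_not_Nil)
  then show "hd (T i j) = E i j" "last (T i j) = E i j"
    using path_U[OF assms] path_V[OF assms] by (simp_all add: T_def hd_pcomp last_pcomp)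
qed

text \<open>The degrees \<open>i + N + 1 - j\<close> of \<open>U\<close> and
  \<open>j - i - 1\<close> of \<open>V\<close> add up to \<open>N\<close>, and the heights cancel on
  a closed path.\<close>

lemma path_weight_T:
  assumes "P i j" "i < j" "j < i + N"
  shows "path_weight (T i j) = 1"
proof -
  have "path_weight (T i j) = path_weight (U i j) + path_weight (V i j)"
    using path_T(4)[OF assms] unfolding T_def by (rule path_weight_pcomp)
  then have "N * int (path_weight (T i j)) = N * 1"
    using path_weight_U[OF assms] path_weight_V[OF assms] by (simp add: algebra_simps)
  then show ?thesis using N_ge_3 by (simp only: mult_cancel_left) simp
qed


section \<open>The congruence generated by the Jacobian relations\<close>

text \<open>The two sides of \<open>jeq_rel\<close> are what remains of a triangle and of the big
  cycle at \<open>i\<close> when their common arrow from \<open>{i, j}\<close> to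
  \<open>{i, k}\<close> is removed, that is, the two terms of a cyclic derivative. The condition
  \<open>diag_at i\<close> selects the arrows that carry a relation. Contexts are built in and
  unrestricted: where composition is undefined, both sides are \<open>[]\<close>.\<close>

inductive jeq :: "pedge list \<Rightarrow> pedge list \<Rightarrow> bool" (infix "\<approx>" 50) where
  jeq_refl [simp]: "p \<approx> p"
| jeq_rel: "triangle i j k \<Longrightarrow> diag_at i \<Longrightarrow>
    x \<odot> [E i k, E j k, E i j] \<odot> y \<approx> x \<odot> (U i k \<odot> V i j) \<odot> y"
| jeq_sym: "p \<approx> q \<Longrightarrow> q \<approx> p"
| jeq_trans [trans]: "p \<approx> q \<Longrightarrow> q \<approx> r \<Longrightarrow> p \<approx> r"

lemma triangle_path:
  assumes "triangle i j k"
  shows "path [E i k, E j k, E i j]"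
  using arrow_snd[OF assms] arrow_mid[OF assms] assms by (simp add: triangle_def path_iff P_def)

lemma path_UV:
  assumes "triangle i j k"
  shows "path (U i k \<odot> V i j)" "hd (U i k \<odot> V i j) = E i k" "last (U i k \<odot> V i j) = E i j"
    "U i k \<odot> V i j \<noteq> []"
proof -
  have t: "P i j" "i < j" "j < i + N" "P i k" "i < k" "k < i + N"
    using assms by (auto simp: triangle_def)
  note UV = path_U[OF t(4-6)] path_V[OF t(1-3)]
  show p: "path (U i k \<odot> V i j)" using UV by (simp add: path_pcomp)
  then show "U i k \<odot> V i j \<noteq> []" by (rule path_not_Nil)
  then show "hd (U i k \<odot> V i j) = E i k" "last (U i k \<odot> V i j) = E i j"
    using UV by (simp_all add: hd_pcomp last_pcomp)
qed

text \<open>Both paths are closed to a minimal cycle of degree \<open>N\<close> by the same arrow of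
  degree \<open>k - j\<close>, so both have degree \<open>N - (k - j)\<close>.\<close>

lemma path_weight_relation:
  assumes "triangle i j k"
  shows "path_weight (U i k \<odot> V i j) = path_weight [E i k, E j k, E i j]"
proof -
  have t: "P i j" "i < j" "j < i + N" "P i k" "i < k" "k < i + N" "j < k"
    using assms by (auto simp: triangle_def)
  have "N * int (weight (E i k) (E j k)) = (j - i) + height (E i k) - height (E j k)"
    using weight_rotate[of i j k] t by (simp add: E_commute)
  moreover have "N * int (weight (E j k) (E i j)) = (i + N - k) + height (E j k) - height (E i j)"
    using weight_rotate[of k "i + N" j] t by (simp add: E_commute)
  moreover have "path_weight (U i k \<odot> V i j) = path_weight (U i k) + path_weight (V i j)"
    using path_UV(4)[OF assms] by (rule path_weight_pcomp)
  ultimately have "N * int (path_weight (U i k \<odot> V i j)) = N * int (path_weight [E i k, E j k, E i j])"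
    using path_weight_U[OF t(4-6)] path_weight_V[OF t(1-3)] by (simp add: algebra_simps)
  then show ?thesis using N_ge_3 by simp
qed

lemma pcomp_parallel_cong:
  assumes "u \<noteq> []" "w \<noteq> []" "hd u = hd w" "last u = last w" "path_weight u = path_weight w"
  shows "x \<odot> u \<odot> y = [] \<longleftrightarrow> x \<odot> w \<odot> y = []" (is ?n)
    and "hd (x \<odot> u \<odot> y) = hd (x \<odot> w \<odot> y)"
    and "last (x \<odot> u \<odot> y) = last (x \<odot> w \<odot> y)"
    and "path_weight (x \<odot> u \<odot> y) = path_weight (x \<odot> w \<odot> y)"
proof -
  have uy: "u \<odot> y = [] \<longleftrightarrow> w \<odot> y = []" using assms by (simp add: pcomp_eq_Nil)
  have hd: "hd (u \<odot> y) = hd (w \<odot> y)" using uy assms(3) hd_pcomp by metis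
  show n: ?n using uy hd by (simp add: pcomp_eq_Nil)
  show "hd (x \<odot> u \<odot> y) = hd (x \<odot> w \<odot> y)"
    using n hd_pcomp by metis
  show "last (x \<odot> u \<odot> y) = last (x \<odot> w \<odot> y)"
    using n last_pcomp by (metis pcomp_Nil)
  show "path_weight (x \<odot> u \<odot> y) = path_weight (x \<odot> w \<odot> y)"
    using n path_weight_pcomp assms(5) by (metis pcomp_Nil(2))
qed

text \<open>The matrix image of a path depends on its ends and its weight only, so these invariants
  put the relations into the kernel.\<close>

lemma jeq_invariants:
  assumes "p \<approx> q"
  shows "hd p = hd q" "last p = last q" "path_weight p = path_weight q" "path p = path q"
    "p = [] \<longleftrightarrow> q = []"
proof -
  have "hd p = hd q \<and> last p = last q \<and> path_weight p = path_weight q \<and> path p = path q \<and>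
    (p = [] \<longleftrightarrow> q = [])"
    using assms
  proof induction
    case (jeq_rel i j k x y)
    show ?case
      using pcomp_parallel_cong[of "[E i k, E j k, E i j]" "U i k \<odot> V i j" x y]
        path_UV[OF jeq_rel(1)] path_weight_relation[OF jeq_rel(1)] triangle_path[OF jeq_rel(1)]
      by (simp add: path_pcomp hd_pcomp pcomp_eq_Nil) (auto simp: path_iff)
  qed auto
  then show "hd p = hd q" "last p = last q" "path_weight p = path_weight q" "path p = path q"
    "p = [] \<longleftrightarrow> q = []" by auto
qed

lemma jeq_cong: "p \<approx> q \<Longrightarrow> x \<odot> p \<odot> y \<approx> x \<odot> q \<odot> y"
proof (induction rule: jeq.induct)
  case (jeq_rel i j k a b)
  then show ?case
    using jeq.jeq_rel[of i j k "x \<odot> a" "b \<odot> y"] by (simp add: pcomp_assoc)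
next
  case (jeq_trans p q r)
  then show ?case using jeq.jeq_trans by blast
qed (auto intro: jeq_sym)

lemma jeq_cong_left: 
  assumes "p \<approx> q"
  shows "x \<odot> p \<approx> x \<odot> q"
proof -
  have "x \<odot> p \<odot> [last p] \<approx> x \<odot> q \<odot> [last p]" by (rule jeq_cong[OF assms])
  then show ?thesis
    using jeq_invariants(2)[OF assms] by (simp add: pcomp_unit_right)
qed

lemma jeq_cong_right: 
  assumes "p \<approx> q"
  shows "p \<odot> y \<approx> q \<odot> y"
proof -
  have "[hd p] \<odot> p \<odot> y \<approx> [hd p] \<odot> q \<odot> y" by (rule jeq_cong[OF assms])
  then show ?thesis
    using jeq_invariants(1)[OF assms] by (simp add: pcomp_unit_left flip: pcomp_assoc)
qed

text \<open>With the length-two path in place of the missing external arrow at an ear, the Jacobian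
  relation at a corner becomes an identity there, so it holds at every corner of a triangle.\<close>
lemma jeq_triangle:
  assumes "triangle i j k"
  shows "[E i k, E j k, E i j] \<approx> U i k \<odot> V i j"
proof (cases "diag_at i")
  case True
  have "[E i k] \<odot> [E i k, E j k, E i j] \<odot> [E i j] \<approx> [E i k] \<odot> (U i k \<odot> V i j) \<odot> [E i j]"
    by (rule jeq_rel[OF assms True])
  then show ?thesis
    using path_UV[OF assms] by (simp add: pcomp_unit_left pcomp_unit_right)
next
  case False
  have jk: "j = i + 1" "k = i + N - 1" using not_diag_at_triangle[OF assms False] by auto
  have "U i k \<odot> V i j = X i"
    using False unfolding U_def V_def jk
    by (simp add: R_refl pcomp_unit_left pcomp_unit_right E_commute[of i "i - 1"])
  also have "X i = [E i k, E j k, E i j]"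
    using False unfolding jk by (simp add: X_def E_commute)
  finally show ?thesis by simp
qed

lemma jeq_triangle_mid:
  assumes "triangle i l k"
  shows "[E i l, E i k, E l k] \<approx> U l (i + N) \<odot> V l k"
  using jeq_triangle[OF triangle_rotate[OF assms]] by (simp add: E_commute)

lemma jeq_triangle_snd:
  assumes "triangle i j k"
  shows "[E j k, E i j, E i k] \<approx> U k (j + N) \<odot> V k (i + N)"
  using jeq_triangle[OF triangle_rotate[OF triangle_rotate[OF assms]]] by (simp add: E_commute)

section \<open>Rotations around different vertices and the full turn\<close>

lemma U_extend_snd:
  assumes "triangle i l k"
  shows "U k (i + N) = [E i k, E l k] \<odot> U k (l + N)"
proof -
  have t: "i < l" "l < k" "k < i + N" "P k l" using assms by (auto simp: triangle_def P_commute)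
  then have "R k (i + N) (k + N - 1) = R k (i + N) (l + N) \<odot> R k (l + N) (k + N - 1)"
    by (intro R_split) auto
  then show ?thesis unfolding U_def R_step_snd[OF assms] by (simp only: pcomp_assoc)
qed

lemma R_extend_fst:
  assumes "triangle i l k" "j \<le> l"
  shows "R i j k = R i j l \<odot> [E i l, E i k]"
  using R_split[of i l j k] assms by (simp add: triangle_def R_step_fst)

lemma V_extend_fst:
  assumes "triangle i l k"
  shows "V i k = V i l \<odot> [E i l, E i k]"
  using R_extend_fst[OF assms] assms by (simp add: V_def triangle_def)

lemma pcomp_two_arrows: "[a, b] \<odot> [b, c] = [a, b, c]"
  by (simp add: pcomp_def)

lemma U_self: "U (i + 1) (i + N) = X (i + 1)"
  by (simp add: U_def R_refl pcomp_unit_left E_commute[of "i + 1" i])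

text \<open>The induction runs over the part of the triangulation cut off by \<open>{i, k}\<close>.\<close>
lemma rotate_past:
  assumes "P i j" "P i k" "i < j" "j \<le> k" "k < i + N"
  shows "R i j k \<odot> U k (i + N) \<approx> U j (i + N) \<odot> XX j k"
  using assms
proof (induction "nat (k - i)" arbitrary: i j k rule: less_induct)
  case less
  show ?case
  proof (cases "j = k")
    case True
    have "P k (i + N)" using less.prems by (simp add: P_commute)
    then have "last (U k (i + N)) = E k (k + 1)" "hd (U k (i + N)) = E i k"
      using less.prems path_U[of k "i + N"] by (simp_all add: E_commute)
    then show ?thesis
      using True less.prems by (simp add: R_refl pcomp_unit_left pcomp_unit_right)
  next
    case False
    then obtain l where l: "j \<le> l" "triangle i l k"
      using previous_neighbour[of i j k] less.prems by auto
    then have t: "i < l" "l < k" "P i l" "P l k" by (auto simp: triangle_def)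
    have IH1: "R i j l \<odot> U l (i + N) \<approx> U j (i + N) \<odot> XX j l"
      using less.prems l t by (intro less.hyps) auto
    \<comment> \<open>In the part cut off by \<open>{l, k}\<close> the rotation starts at the side
      \<open>{l, l + 1}\<close>, so that \<open>U\<close> there shrinks to \<open>X (l + 1)\<close>
      and the result is a pure run along the sides.\<close>
    have "R l (l + 1) k \<odot> U k (l + N) \<approx> U (l + 1) (l + N) \<odot> XX (l + 1) k"
      using less.prems l t by (intro less.hyps) auto
    also have "U (l + 1) (l + N) \<odot> XX (l + 1) k = XX l k"
      using XX_append[of "l + 1" k l] t by (simp add: U_self XX_single)
    finally have IH2: "V l k \<odot> U k (l + N) \<approx> XX l k" by (simp add: V_def)
    \<comment> \<open>The last arrow around \<open>i\<close> and the first arrow around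
      \<open>k\<close> both lie in the triangle \<open>i l k\<close>; together they can be traded
      for the long rotation around \<open>l\<close>.\<close>
    have "R i j k \<odot> U k (i + N) = R i j l \<odot> [E i l, E i k, E l k] \<odot> U k (l + N)"
      using l by (simp add: R_extend_fst U_extend_snd pcomp_assoc flip: pcomp_two_arrows)
    also have "\<dots> \<approx> R i j l \<odot> (U l (i + N) \<odot> V l k) \<odot> U k (l + N)"
      by (rule jeq_cong[OF jeq_triangle_mid[OF l(2)]])
    also have "\<dots> = (R i j l \<odot> U l (i + N)) \<odot> V l k \<odot> U k (l + N)"
      by (simp add: pcomp_assoc)
    also have "\<dots> \<approx> (U j (i + N) \<odot> XX j l) \<odot> V l k \<odot> U k (l + N)"
      by (rule jeq_cong_right[OF IH1])
    also have "\<dots> \<approx> (U j (i + N) \<odot> XX j l) \<odot> XX l k"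
      by (rule jeq_cong_left[OF IH2])
    also have "\<dots> = U j (i + N) \<odot> XX j k"
      using XX_append[of l k j] l t by (simp add: pcomp_assoc)
    finally show ?thesis .
  qed
qed

lemma V_U:
  assumes "P i k" "i < k" "k < i + N"
  shows "V i k \<odot> U k (i + N) \<approx> XX i k"
  using rotate_past[of i "i + 1" k] XX_append[of "i + 1" k i] assms
  by (simp add: U_self XX_single V_def)

text \<open>The relation at corner \<open>i\<close> replaces all but the last arrow of the turn
  around \<open>i\<close> by two arrows of an adjacent triangle. The turn becomes the boundary of
  this triangle, and the relation at corner \<open>j\<close> unfolds it into the turn around
  \<open>j\<close>.\<close>

lemma T_commute:
  assumes "P i j" "i < j" "j < i + N"
  shows "T i j \<approx> T j (i + N)"
proof -
  have *: "T i j \<approx> T j (i + N)" if ij: "P i j" "i + 1 < j" "j < i + N" for i j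
  proof -
    obtain k where k: "i < k" "k < j" "P i k" "P k j"
      using triangle_below[OF ij] by metis
    then have t: "triangle i k j" using ij by (simp add: triangle_def)
    have "T i j = (U i j \<odot> V i k) \<odot> [E i k, E i j]"
      by (simp add: T_def V_extend_fst[OF t] pcomp_assoc)
    also have "\<dots> \<approx> [E i j, E k j, E i k] \<odot> [E i k, E i j]"
      by (rule jeq_cong_right[OF jeq_sym[OF jeq_triangle[OF t]]])
    also have "\<dots> = [E i j, E k j] \<odot> [E k j, E i k, E i j]"
      by (simp add: pcomp_def)
    also have "\<dots> \<approx> [E i j, E k j] \<odot> U j (k + N) \<odot> V j (i + N)"
      by (rule jeq_cong_left[OF jeq_triangle_snd[OF t]])
    also have "\<dots> = T j (i + N)"
      by (simp add: T_def U_extend_snd[OF t] pcomp_assoc)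
    finally show ?thesis .
  qed
  show ?thesis
  proof (cases "i + 1 < j")
    case True
    then show ?thesis using * assms by blast
  next
    case False
    \<comment> \<open>For \<open>j = i + 1\<close> there is no triangle on this side of the edge;
      the one on the other side exists because \<open>n \<ge> 3\<close>.\<close>
    then have "T j (i + N) \<approx> T (i + N) (j + N)"
      using assms N_ge_3 by (intro *) (auto simp: P_commute)
    then show ?thesis by (simp add: jeq_sym)
  qed
qed

text \<open>Both sides list the same edges around \<open>i\<close>, hence an equality and not merely
  a congruence.\<close>

lemma R_T:
  assumes "P i j" "P i k" "i < j" "j \<le> k" "k < i + N"
  shows "R i j k \<odot> T i k = T i j \<odot> R i j k"
proof -
  have "P i (i + N - 1)" using P_next by simp
  then have "R i j k \<odot> U i k = U i j"
    using R_split[of i k j "i + N - 1"] assms by (simp add: U_def pcomp_assoc)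
  moreover have "V i j \<odot> R i j k = V i k"
    using R_split[of i j "i + 1" k] assms by (simp add: V_def)
  ultimately show ?thesis by (metis T_def pcomp_assoc)
qed

lemma V_next: "V i (i + 1) = [E i (i + 1)]"
  by (simp add: V_def R_refl)

lemma U_T:
  assumes "P i j" "i < j" "j < i + N"
  shows "U i j \<odot> T i (i + 1) = T i j \<odot> U i j"
proof -
  have "T i (i + 1) = U i (i + 1)"
    using path_U[of i "i + 1"] N_ge_3 by (simp add: T_def V_next pcomp_unit_right)
  moreover have "V i j \<odot> U i j = U i (i + 1)"
    using R_split[of i j "i + 1" "i + N - 1"] assms by (simp add: U_def V_def pcomp_assoc)
  ultimately show ?thesis by (metis T_def pcomp_assoc)
qed

lemma X_T: "X (i + 1) \<odot> T (i + 1) (i + 1 + 1) \<approx> T i (i + 1) \<odot> X (i + 1)"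
proof -
  have "X (i + 1) \<odot> T (i + 1) (i + 1 + 1) = T (i + 1) (i + N) \<odot> X (i + 1)"
    using U_T[of "i + 1" "i + N"] N_ge_3 by (simp add: U_self)
  also have "\<dots> \<approx> T i (i + 1) \<odot> X (i + 1)"
    using N_ge_3 by (intro jeq_cong_right jeq_sym[OF T_commute]) auto
  finally show ?thesis .
qed

lemma XX_T: "i \<le> j \<Longrightarrow> XX i j \<odot> T j (j + 1) \<approx> T i (i + 1) \<odot> XX i j"
proof (induction rule: int_ge_induct)
  case base
  then show ?case
    using path_T[of i "i + 1"] N_ge_3 by (simp add: pcomp_unit_left pcomp_unit_right)
next
  case (step j)
  have "XX i (j + 1) \<odot> T (j + 1) (j + 1 + 1) = XX i j \<odot> X (j + 1) \<odot> T (j + 1) (j + 1 + 1)"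
    using step by (simp add: XX_Suc pcomp_assoc)
  also have "\<dots> \<approx> XX i j \<odot> T j (j + 1) \<odot> X (j + 1)"
    by (rule jeq_cong_left[OF X_T])
  also have "\<dots> \<approx> (T i (i + 1) \<odot> XX i j) \<odot> X (j + 1)"
    using jeq_cong_right[OF step.IH] by (simp add: pcomp_assoc)
  also have "\<dots> = T i (i + 1) \<odot> XX i (j + 1)"
    using step by (simp add: XX_Suc pcomp_assoc)
  finally show ?case .
qed

text \<open>The run along the sides is a rotation around \<open>i\<close> followed by one around
  \<open>j\<close>, and \<open>V j (i + N)\<close> completes the latter to a full turn, which moves
  to the front. This shortens paths that overshoot their target along the sides.\<close>

lemma XX_V:
  assumes "P i j" "i < j" "j < i + N"
  shows "XX i j \<odot> V j (i + N) \<approx> T i (i + 1) \<odot> V i j"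
proof -
  have "XX i j \<odot> V j (i + N) \<approx> (V i j \<odot> U j (i + N)) \<odot> V j (i + N)"
    by (rule jeq_cong_right[OF jeq_sym[OF V_U[OF assms]]])
  also have "\<dots> = V i j \<odot> T j (i + N)" by (simp add: T_def pcomp_assoc)
  also have "\<dots> \<approx> V i j \<odot> T i j"
    by (rule jeq_cong_left[OF jeq_sym[OF T_commute[OF assms]]])
  also have "\<dots> = T i (i + 1) \<odot> V i j"
    using R_T[of i "i + 1" j] assms by (simp add: V_def)
  finally show ?thesis .
qed


section \<open>Normal forms of paths\<close>

text \<open>The canonical path from \<open>{i, j}\<close> to an edge \<open>{a, b}\<close> with \<open>j \<le> a < b \<le> i + n\<close>, that is, on one
  fixed side of \<open>{i, j}\<close>. The edges on the other side are covered by \<open>(j, i + n)\<close>.\<close>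
definition canonical :: "int \<Rightarrow> int \<Rightarrow> int \<Rightarrow> int \<Rightarrow> pedge list" where
  "canonical i j a b = (if b = i + N then R i j a else U j (i + N) \<odot> XX j a \<odot> V a b)"

definition target :: "int \<Rightarrow> int \<Rightarrow> int \<Rightarrow> int \<Rightarrow> bool" where
  "target i j a b \<longleftrightarrow> P a b \<and> j \<le> a \<and> a < b \<and> b \<le> i + N"

definition normal :: "int \<Rightarrow> int \<Rightarrow> pedge list \<Rightarrow> bool" where
  "normal i j p \<longleftrightarrow> (\<exists>a b k. target i j a b \<and> p \<approx> ((\<odot>) (T i j) ^^ k) (canonical i j a b))"

lemma jeq_pow: "p \<approx> q \<Longrightarrow> ((\<odot>) t ^^ k) p \<approx> ((\<odot>) t ^^ k) q"
  by (induction k) (auto intro: jeq_cong_left)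

lemma jeq_pow_base: "t \<approx> t' \<Longrightarrow> ((\<odot>) t ^^ k) p \<approx> ((\<odot>) t' ^^ k) p"
  by (induction k) (auto intro: jeq_trans[OF jeq_cong_left jeq_cong_right])

lemma pow_pcomp: "((\<odot>) t ^^ k) p \<odot> q = ((\<odot>) t ^^ k) (p \<odot> q)"
  by (induction k) (auto simp: pcomp_assoc)

lemma pow_pow: "((\<odot>) t ^^ k) (((\<odot>) t ^^ l) p) = ((\<odot>) t ^^ (k + l)) p"
  by (simp add: funpow_add)

lemma normal_canonical:
  "target i j a b \<Longrightarrow> p \<approx> canonical i j a b \<Longrightarrow> normal i j p"
  unfolding normal_def by (intro exI[of _ a] exI[of _ b] exI[of _ 0]) simp

lemma normal_pow:
  assumes "normal i j p" "q \<approx> ((\<odot>) (T i j) ^^ k) p"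
  shows "normal i j q"
proof -
  obtain a b l where *: "target i j a b" "p \<approx> ((\<odot>) (T i j) ^^ l) (canonical i j a b)"
    using assms(1) by (auto simp: normal_def)
  have "q \<approx> ((\<odot>) (T i j) ^^ (k + l)) (canonical i j a b)"
    using jeq_trans[OF assms(2) jeq_pow[OF *(2)]] by (simp add: pow_pow)
  then show ?thesis using *(1) unfolding normal_def by blast
qed

lemma normal_jeq: "normal i j p \<Longrightarrow> q \<approx> p \<Longrightarrow> normal i j q"
  using normal_pow[of i j p q 0] by simp

lemma normal_T: "normal i j p \<Longrightarrow> q \<approx> T i j \<odot> p \<Longrightarrow> normal i j q"
  using normal_pow[of i j p q 1] by simp

context
  fixes i j :: int
  assumes base: "P i j" "i < j" "j < i + N"
begin

lemma P_base: "P j (i + N)"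
  using base by (simp add: P_commute)

lemma path_canonical:
  assumes "target i j a b"
  shows "path (canonical i j a b)" "hd (canonical i j a b) = E i j" "last (canonical i j a b) = E a b"
proof -
  note t = assms[unfolded target_def]
  have "path (canonical i j a b) \<and> hd (canonical i j a b) = E i j \<and> last (canonical i j a b) = E a b"
  proof (cases "b = i + N")
    case True
    then have "P i a" using t by (simp add: P_commute)
    then show ?thesis
      using True t base path_R[of i j a] hd_R[of i j a] last_R[of i a j]
      by (simp add: canonical_def E_commute)
  next
    case False
    have V: "path (V a b)" "hd (V a b) = E a (a + 1)" "last (V a b) = E a b"
      using path_V[of a b] t base by auto
    note U = path_U[OF P_base] and XX = path_XX[of j a]
    have *: "path (XX j a \<odot> V a b)" "hd (XX j a \<odot> V a b) = E j (j + 1)" "last (XX j a \<odot> V a b) = E a b"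
      using V XX t path_not_Nil[of "XX j a \<odot> V a b"] by (auto simp: path_pcomp hd_pcomp last_pcomp)
    then have "path (U j (i + N) \<odot> XX j a \<odot> V a b)"
      using U base by (simp add: path_pcomp)
    moreover from path_not_Nil[OF this]
    have "hd (U j (i + N) \<odot> XX j a \<odot> V a b) = E j i" "last (U j (i + N) \<odot> XX j a \<odot> V a b) = E a b"
      using * U base by (simp_all add: hd_pcomp last_pcomp)
    ultimately show ?thesis
      using False by (simp add: canonical_def E_commute)
  qed
  then show "path (canonical i j a b)" "hd (canonical i j a b) = E i j" "last (canonical i j a b) = E a b"
    by auto
qed

lemma path_pow_T:
  assumes "path m" "hd m = E i j"
  shows "path (((\<odot>) (T i j) ^^ k) m)" "hd (((\<odot>) (T i j) ^^ k) m) = E i j"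
    "last (((\<odot>) (T i j) ^^ k) m) = last m" "path_weight (((\<odot>) (T i j) ^^ k) m) = k + path_weight m"
proof -
  have "path (((\<odot>) (T i j) ^^ k) m) \<and> hd (((\<odot>) (T i j) ^^ k) m) = E i j \<and>
    last (((\<odot>) (T i j) ^^ k) m) = last m \<and> path_weight (((\<odot>) (T i j) ^^ k) m) = k + path_weight m"
  proof (induction k)
    case 0
    then show ?case using assms by simp
  next
    case (Suc k)
    let ?q = "((\<odot>) (T i j) ^^ k) m"
    have p: "path (T i j \<odot> ?q)" using Suc path_T[OF base] by (simp add: path_pcomp)
    then have "T i j \<odot> ?q \<noteq> []" by (rule path_not_Nil)
    then show ?case
      using p Suc path_T[OF base] path_weight_T[OF base]
      by (simp add: hd_pcomp last_pcomp path_weight_pcomp)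
  qed
  then show "path (((\<odot>) (T i j) ^^ k) m)" "hd (((\<odot>) (T i j) ^^ k) m) = E i j"
    "last (((\<odot>) (T i j) ^^ k) m) = last m" "path_weight (((\<odot>) (T i j) ^^ k) m) = k + path_weight m"
    by auto
qed

lemma normal_R:
  assumes "P i k" "j \<le> k" "k < i + N"
  shows "normal i j (R i j k)"
  using assms by (intro normal_canonical[of i j k "i + N"]) (auto simp: target_def canonical_def P_commute)

text \<open>For \<open>b = i + N\<close> the path is the canonical one with an additional full turn:
  the rotation around \<open>a\<close> back to \<open>{a, i}\<close> closes a turn, leaving a plain
  rotation around \<open>i\<close>. Hence the case distinction in \<open>canonical\<close>.\<close>

lemma normal_UXV:
  assumes "P a b" "j \<le> a" "a < b" "b \<le> i + N"
  shows "normal i j (U j (i + N) \<odot> XX j a \<odot> V a b)"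
proof (cases "b = i + N")
  case False
  then show ?thesis
    using assms by (intro normal_canonical[of i j a b]) (auto simp: target_def canonical_def)
next
  case True
  have a: "P i a" "a < i + N" using assms True by (auto simp: P_commute)
  have "U j (i + N) \<odot> XX j a \<odot> V a b = (U j (i + N) \<odot> XX j a) \<odot> V a (i + N)"
    using True by (simp add: pcomp_assoc)
  also have "\<dots> \<approx> (R i j a \<odot> U a (i + N)) \<odot> V a (i + N)"
    using base a assms by (intro jeq_cong_right jeq_sym[OF rotate_past]) auto
  also have "\<dots> = R i j a \<odot> T a (i + N)" by (simp add: T_def pcomp_assoc)
  also have "\<dots> \<approx> R i j a \<odot> T i a"
    using a base assms by (intro jeq_cong_left jeq_sym[OF T_commute]) auto
  also have "\<dots> = T i j \<odot> R i j a"
    using a base assms by (intro R_T) auto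
  finally show ?thesis
    using normal_R[of a] a assms normal_T by blast
qed

end

section \<open>Appending an arrow to a normal form\<close>

definition good :: "int \<Rightarrow> int \<Rightarrow> pedge list \<Rightarrow> bool" where
  "good i j p \<longleftrightarrow> normal i j p \<or> normal j (i + N) p"

text \<open>Passing to the other part twice turns \<open>(i, j)\<close> into
  \<open>(i + N, j + N)\<close>, new lifts of the same edge. This makes \<open>good\<close>
  symmetric in the two parts.\<close>

lemma normal_shift [simp]: "normal (i + N) (j + N) p = normal i j p"
proof -
  have *: "normal (i + c) (j + c) p" if normal: "normal i j p" and c: "c = N \<or> c = - N" for i j c
  proof -
    obtain a b k where ab: "target i j a b" "p \<approx> ((\<odot>) (T i j) ^^ k) (canonical i j a b)"
      using normal unfolding normal_def by blast
    have sh: "R (i + c) (j + c) (a + c) = R i j a" "U (j + c) (i + c + N) = U j (i + N)"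
      "V (a + c) (b + c) = V a b" "T (i + c) (j + c) = T i j" "P (a + c) (b + c) = P a b" for i j a b
      using c R_shift[of "i - N" "j - N" "a - N"] R_shift2[of i "j - N" "a - N"]
        U_shift[of "j - N" i] U_shift[of j "i + N"] V_shift[of "a - N" "b - N"] T_shift[of "i - N" "j - N"]
        R_shift[of "i - N" j a]
      by (auto simp: algebra_simps)
    have XXc: "XX (j + c) (a + c) = XX j a" for j a
    proof -
      have Xc: "X (l + c) = X l" for l
        using c X_shift[of "l - N"] by (auto simp: algebra_simps)
      have Ec: "E (l + c) (l + c + 1) = E l (l + 1)" for l
      proof -
        have "N dvd c" using c by auto
        then have "E (l + c) (l + 1 + c) = E l (l + 1)" by (simp only: E_shift_dvd)
        then show ?thesis by (simp add: algebra_simps)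
      qed
      have "XX_nat (j + c) m = XX_nat j m" for m
      proof (induction m)
        case 0
        then show ?case using Ec[of j] by simp
      next
        case (Suc m)
        have "j + c + int m + 1 = (j + int m + 1) + c" by simp
        then have "X (j + c + int m + 1) = X (j + int m + 1)" by (simp only: Xc)
        then show ?case using Suc by simp
      qed
      then show ?thesis by (simp add: XX_def)
    qed
    have "canonical (i + c) (j + c) (a + c) (b + c) = canonical i j a b"
      using sh XXc by (auto simp: canonical_def)
    moreover have "target (i + c) (j + c) (a + c) (b + c)"
      using ab(1) sh by (auto simp: target_def)
    ultimately show ?thesis
      using ab(2) sh unfolding normal_def by metis
  qed
  show ?thesis using *[of i j N] *[of "i + N" "j + N" "- N"] by auto
qed

lemma good_swap: "good j (i + N) p \<longleftrightarrow> good i j p"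
  by (auto simp: good_def)

text \<open>An arrow around \<open>i\<close> extends the rotation, and one around \<open>k\<close>
  is rewritten through its triangle. The path enters the other part in two ways only: from
  \<open>{i, j}\<close> itself by an arrow around \<open>j\<close>, or by the external arrow at
  \<open>i\<close>.\<close>

lemma good_R_arrow:
  assumes base: "P i j" "i < j" "j < i + N"
    and k: "P i k" "j \<le> k" "k < i + N"
    and arrow: "(E i k, g) \<in> arrows n D"
  shows "good i j (R i j k \<odot> [E i k, g])"
proof -
  have base': "P j (i + N)" "j < i + N" "i + N < j + N" using base by (auto simp: P_commute)
  from arrow have "i < k" using base k by simp
  show ?thesis
    using arrow \<open>i < k\<close> k(3)
  proof (cases rule: arrow_cases)
    case (fst l)
    then have "R i j k \<odot> [E i k, g] = R i j l"
      using R_extend_fst k by simp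
    then show ?thesis
      using normal_R[OF base, of l] fst k by (auto simp: good_def triangle_def)
  next
    case (snd l)
    then have l: "i < l" "l < k" "P i l" "P l k" by (auto simp: triangle_def)
    show ?thesis
    proof (cases "k = j")
      case True
      have "R i j k \<odot> [E i k, g] = R j (i + N) (l + N)"
        using True snd R_step_snd[OF snd(1)] k
        by (simp add: R_refl pcomp_unit_left E_commute del: R_shift2)
      then show ?thesis
        using normal_R[OF base', of "l + N"] True l by (simp add: good_def P_commute del: R_shift2)
    next
      case False
      have "j \<le> l"
        using P_noncrossing[of i j l k] base l k False by fastforce
      have "R i j k \<odot> [E i k, g] = R i j l \<odot> [E i l, E i k, E l k]"
        using R_extend_fst[OF snd(1) \<open>j \<le> l\<close>] snd(2)
        by (simp add: pcomp_assoc pcomp_two_arrows E_commute)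
      also have "\<dots> \<approx> R i j l \<odot> U l (i + N) \<odot> V l k"
        by (rule jeq_cong_left[OF jeq_triangle_mid[OF snd(1)]])
      also have "\<dots> \<approx> (U j (i + N) \<odot> XX j l) \<odot> V l k"
        unfolding pcomp_assoc[symmetric]
        using base l k \<open>j \<le> l\<close> by (intro jeq_cong_right rotate_past) auto
      finally show ?thesis
        using normal_UXV[OF base, of l k] l k \<open>j \<le> l\<close> normal_jeq
        unfolding good_def pcomp_assoc by fastforce
    qed
  next
    case ext_fst
    have "R i j k \<odot> [E i k, g] = R i j (i + N - 1) \<odot> X i"
      using ext_fst by (simp add: X_def E_commute)
    then have *: "R i j k \<odot> [E i k, g] = U i j" by (simp add: U_def)
    show ?thesis
    proof (cases "j = i + 1")
      case True
      \<comment> \<open>Here the external arrow ends at the start edge and closes the full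
        turn.\<close>
      have "U i j = T i j \<odot> R i j j"
        using True path_T(3)[OF base] path_U(3)[OF base]
        by (simp add: T_def V_next R_refl pcomp_unit_right)
      then show ?thesis
        using normal_T[OF normal_R[OF base base(1) _ base(3)]] * by (simp add: good_def)
    next
      case False
      \<comment> \<open>A degenerate canonical path for the other part: the target is the side
        \<open>{i, i + 1}\<close>, so neither a run along the sides nor a final rotation
        follows.\<close>
      have "U i j = U (i + N) (j + N) \<odot> XX (i + N) (i + N) \<odot> V (i + N) (i + N + 1)"
        using path_U[OF base] by (simp add: V_next pcomp_unit_right)
      moreover have "normal j (i + N) \<dots>"
        using False base by (intro normal_UXV[OF base']) auto
      ultimately show ?thesis using * by (simp add: good_def)
    qed
  next
    case ext_snd
    then have j: "k = j" "j = i + 1" using k base by auto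
    have u: "U j (i + N) = X j" using j(2) by (simp add: U_self)
    have "R i j k \<odot> [E i k, g] = X j"
      using ext_snd j by (simp add: X_def R_refl pcomp_unit_left)
    also have "\<dots> = U j (i + N) \<odot> XX j j \<odot> V j (j + 1)"
      unfolding u XX_refl V_next by (simp add: pcomp_unit_right)
    finally have "R i j k \<odot> [E i k, g] = U j (i + N) \<odot> XX j j \<odot> V j (j + 1)" .
    moreover have "normal i j \<dots>"
      by (rule normal_UXV[OF base P_next(1)]; use j N_ge_3 in linarith)
    ultimately show ?thesis by (simp only: good_def) blast
  qed
qed

text \<open>The bounds on \<open>w\<close> and \<open>z\<close> keep the current edge away from
  \<open>i\<close>, so no arrow from it leads into the other part, and the conclusion is
  \<open>normal\<close> rather than \<open>good\<close>.\<close>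

lemma good_UXV_arrow:
  assumes base: "P i j" "i < j" "j < i + N"
    and wz: "P w z" "j \<le> w" "w < z" "z < i + N"
    and arrow: "(E w z, g) \<in> arrows n D"
  shows "normal i j (U j (i + N) \<odot> XX j w \<odot> V w z \<odot> [E w z, g])"
proof -
  have base': "P j (i + N)" "j < i + N" "i + N < j + N" using base by (auto simp: P_commute)
  have "z < w + N" using base wz by simp
  with arrow \<open>w < z\<close> show ?thesis
  proof (cases rule: arrow_cases)
    case (fst b)
    then have b: "z < b" "b < w + N" "P w b" "P z b" by (auto simp: triangle_def)
    have eq: "V w z \<odot> [E w z, g] = V w b" using V_extend_fst fst by simp
    show ?thesis
    proof (cases "b \<le> i + N")
      case True
      then show ?thesis
        using normal_UXV[OF base, of w b] b wz eq by simp
    next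
      case False
      \<comment> \<open>The moving end has passed \<open>i + N\<close>. Since \<open>{z, b}\<close>
        cannot cross \<open>{i, j}\<close>, it reappears at or after \<open>j\<close>; the target is
        \<open>{a, w}\<close> with \<open>a < w\<close>, and the surplus over its canonical path is
        a full turn.\<close>
      define a where "a = b - N"
      have "j + N \<le> b"
        using P_noncrossing[OF base'(1), of z b] b wz False base by fastforce
      then have a: "j \<le> a" "a < w" "P a w" "w < a + N" "b = a + N"
        using b wz base by (auto simp: a_def P_commute)
      have "U j (i + N) \<odot> XX j w \<odot> V w b = (U j (i + N) \<odot> XX j a) \<odot> XX a w \<odot> V w (a + N)"
        using XX_append[of a w j] a by (simp add: pcomp_assoc)
      also have "\<dots> \<approx> (U j (i + N) \<odot> XX j a) \<odot> T a (a + 1) \<odot> V a w"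
        using a by (intro jeq_cong_left XX_V) auto
      also have "\<dots> = U j (i + N) \<odot> (XX j a \<odot> T a (a + 1)) \<odot> V a w"
        by (simp add: pcomp_assoc)
      also have "\<dots> \<approx> U j (i + N) \<odot> (T j (j + 1) \<odot> XX j a) \<odot> V a w"
        using a by (intro jeq_cong XX_T) auto
      also have "\<dots> = (U j (i + N) \<odot> T j (j + 1)) \<odot> XX j a \<odot> V a w"
        by (simp add: pcomp_assoc)
      also have "\<dots> = T j (i + N) \<odot> U j (i + N) \<odot> XX j a \<odot> V a w"
        using U_T[OF base'] by (simp add: pcomp_assoc)
      also have "\<dots> \<approx> T i j \<odot> U j (i + N) \<odot> XX j a \<odot> V a w"
        by (intro jeq_cong_right jeq_sym[OF T_commute[OF base]])
      finally show ?thesis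
        using normal_UXV[OF base, of a w] a wz normal_T eq by force
    qed
  next
    case (snd l)
    then have l: "w < l" "l < z" "P w l" "P l z" by (auto simp: triangle_def)
    have "V w z \<odot> [E w z, g] = V w l \<odot> [E w l, E w z, E l z]"
      using V_extend_fst[OF snd(1)] snd(2) by (simp add: pcomp_assoc pcomp_two_arrows E_commute)
    also have "\<dots> \<approx> V w l \<odot> U l (w + N) \<odot> V l z"
      by (rule jeq_cong_left[OF jeq_triangle_mid[OF snd(1)]])
    also have "\<dots> \<approx> XX w l \<odot> V l z"
      unfolding pcomp_assoc[symmetric]
      using l \<open>z < w + N\<close> by (intro jeq_cong_right V_U) auto
    finally have "U j (i + N) \<odot> XX j w \<odot> V w z \<odot> [E w z, g] \<approx> U j (i + N) \<odot> XX j w \<odot> XX w l \<odot> V l z"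
      by (intro jeq_cong_left)
    also have "\<dots> = U j (i + N) \<odot> XX j l \<odot> V l z"
      using XX_append[of w l j] l wz by (simp add: pcomp_assoc)
    finally show ?thesis
      using normal_UXV[OF base, of l z] l wz normal_jeq by force
  next
    case ext_fst
    then show ?thesis using wz base by simp
  next
    case ext_snd
    have "V w z \<odot> [E w z, g] = X z"
      using ext_snd by (simp add: X_def V_next pcomp_unit_left)
    then have "U j (i + N) \<odot> XX j w \<odot> V w z \<odot> [E w z, g] = U j (i + N) \<odot> XX j z \<odot> V z (z + 1)"
      using wz path_XX[of j z] XX_Suc[of j w] unfolding V_next[of z] ext_snd(1)[symmetric]
      by (simp add: pcomp_unit_right pcomp_assoc)
    then show ?thesis
      using normal_UXV[OF base, of z "z + 1"] wz by simp
  qed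
qed

lemma good_snoc:
  assumes base: "P i j" "i < j" "j < i + N"
    and "good i j p" "(last p, g) \<in> arrows n D"
  shows "good i j (p \<odot> [last p, g])"
proof -
  have *: "good i j (p \<odot> [last p, g])"
    if base: "P i j" "i < j" "j < i + N" and p: "normal i j p" "(last p, g) \<in> arrows n D" for i j
  proof -
    obtain a b k where ab: "target i j a b" "p \<approx> ((\<odot>) (T i j) ^^ k) (canonical i j a b)"
      using p(1) by (auto simp: normal_def)
    let ?m = "canonical i j a b"
    have lm: "last p = E a b"
      using jeq_invariants(2)[OF ab(2)] path_pow_T[OF base] path_canonical[OF base ab(1)] by simp
    have "good i j (?m \<odot> [last p, g])"
    proof (cases "b = i + N")
      case True
      then have "last p = E i a" using lm by (simp add: E_commute)
      then show ?thesis
        using good_R_arrow[OF base, of a g] ab(1) True p(2) by (simp add: canonical_def target_def P_commute)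
    next
      case False
      then show ?thesis
        using good_UXV_arrow[OF base, of a b g] ab(1) p(2) lm
        by (simp add: canonical_def target_def good_def pcomp_assoc)
    qed
    moreover have eq: "p \<odot> [last p, g] \<approx> ((\<odot>) (T i j) ^^ k) (?m \<odot> [last p, g])"
      using jeq_cong_right[OF ab(2)] by (simp add: pow_pcomp)
    \<comment> \<open>If the arrow leads into the other part, the powers already extracted must be
      full turns for that part; \<open>T_commute\<close> converts them.\<close>
    moreover have "p \<odot> [last p, g] \<approx> ((\<odot>) (T j (i + N)) ^^ k) (?m \<odot> [last p, g])"
      using jeq_trans[OF eq jeq_pow_base[OF T_commute[OF base]]] .
    ultimately show ?thesis
      unfolding good_def using normal_pow by blast
  qed
  show ?thesis
    using assms(4) *[OF base _ assms(5)] *[of j "i + N"] assms(5) base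
    unfolding good_swap by (auto simp: good_def P_commute)
qed

lemma path_good:
  assumes base: "P i j" "i < j" "j < i + N"
    and "path p" "hd p = E i j"
  shows "good i j p"
  using assms(4,5)
proof (induction p rule: rev_induct)
  case Nil
  then show ?case by (simp add: path_iff)
next
  case (snoc g p)
  show ?case
  proof (cases "p = []")
    case True
    then show ?thesis
      using snoc normal_R[OF base base(1)] base by (simp add: good_def R_refl)
  next
    case False
    then have "path p" "(last p, g) \<in> arrows n D"
      using snoc.prems by (auto simp: path_iff successively_append_iff)
    moreover have "p @ [g] = p \<odot> [last p, g]" using False by (simp add: pcomp_def)
    ultimately show ?thesis
      using snoc.IH snoc.prems(2) False good_snoc[OF base, of p g] by (metis hd_append2)
  qed
qed

section \<open>Uniqueness of normal forms\<close>

lemma normal_unique: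
  assumes base: "P i j" "i < j" "j < i + N"
    and "normal i j p" "normal i j q" "last p = last q" "path_weight p = path_weight q"
  shows "p \<approx> q"
proof -
  obtain a b k where ab: "target i j a b" "p \<approx> ((\<odot>) (T i j) ^^ k) (canonical i j a b)"
    using assms(4) by (auto simp: normal_def)
  obtain c d l where cd: "target i j c d" "q \<approx> ((\<odot>) (T i j) ^^ l) (canonical i j c d)"
    using assms(5) by (auto simp: normal_def)
  note pc = path_canonical[OF base ab(1)] path_canonical[OF base cd(1)]
  have w: "j \<le> a" "a < b" "b \<le> i + N" "j \<le> c" "c < d" "d \<le> i + N" "i < j" "j < i + N"
    using ab(1) cd(1) base by (auto simp: target_def)
  have "E a b = E c d"
    using jeq_invariants(2)[OF ab(2)] jeq_invariants(2)[OF cd(2)] path_pow_T(3)[OF base] pc assms(6) by simp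
  \<comment> \<open>All four ends lie between \<open>j\<close> and \<open>i + N\<close>, an interval
    shorter than \<open>N\<close>, so their residues determine them; \<open>a < b\<close> and
    \<open>c < d\<close> rule out the exchanged matching.\<close>
  then consider "a mod N = c mod N" "b mod N = d mod N" | "a mod N = d mod N" "b mod N = c mod N"
    unfolding E_eq_iff by blast
  then have "a = c \<and> b = d"
  proof cases
    case 1
    have "a = c" "b = d" by (rule mod_eq_window[OF 1(1)] mod_eq_window[OF 1(2)], use w in linarith)+
    then show ?thesis by simp
  next
    case 2
    have "a = d" "b = c" by (rule mod_eq_window[OF 2(1)] mod_eq_window[OF 2(2)], use w in linarith)+
    then show ?thesis using w by linarith
  qed
  moreover from this have "k = l"
    using jeq_invariants(3)[OF ab(2)] jeq_invariants(3)[OF cd(2)] path_pow_T(4)[OF base] pc assms(7) by simp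
  ultimately show ?thesis using ab(2) cd(2) jeq_sym jeq_trans by metis
qed

text \<open>The two parts share only the edge \<open>{i, j}\<close>, so a common target is this
  edge. Its canonical path is trivial on either side, and the full turns agree.\<close>

lemma normal_unique_opposite:
  assumes base: "P i j" "i < j" "j < i + N"
    and "normal i j p" "normal j (i + N) q" "last p = last q"
  shows "normal i j q"
proof -
  have base': "P j (i + N)" "j < i + N" "i + N < j + N" using base by (auto simp: P_commute)
  obtain a b k where ab: "target i j a b" "p \<approx> ((\<odot>) (T i j) ^^ k) (canonical i j a b)"
    using assms(4) by (auto simp: normal_def)
  obtain c d l where cd: "target j (i + N) c d" "q \<approx> ((\<odot>) (T j (i + N)) ^^ l) (canonical j (i + N) c d)"
    using assms(5) by (auto simp: normal_def)
  have "E a b = E c d"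
    using jeq_invariants(2)[OF ab(2)] jeq_invariants(2)[OF cd(2)] path_pow_T(3)[OF base]
      path_pow_T(3)[OF base'] path_canonical[OF base ab(1)] path_canonical[OF base' cd(1)] assms(6)
    by (simp add: E_commute)
  then have "(a mod N = c mod N \<and> b mod N = d mod N) \<or> ((a + N) mod N = d mod N \<and> b mod N = c mod N)"
    unfolding E_eq_iff by simp
  moreover have w: "j \<le> a" "a < b" "b \<le> i + N" "i + N \<le> c" "c < d" "d \<le> j + N"
    using ab(1) cd(1) by (auto simp: target_def)
  ultimately have "c = i + N \<and> d = j + N"
    using mod_eq_window[of a c] mod_eq_window[of "a + N" d] mod_eq_window[of b c] base
    by linarith
  then have "canonical j (i + N) c d = R i j j"
    using base by (simp add: canonical_def R_refl P_commute E_commute)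
  then have "q \<approx> ((\<odot>) (T i j) ^^ l) (R i j j)"
    using cd(2) jeq_pow_base[OF jeq_sym[OF T_commute[OF base]]] jeq_trans by metis
  then show ?thesis
    using normal_pow normal_R[OF base base(1)] base by blast
qed

lemma edge_lift:
  assumes "e \<in> edges n D"
  obtains i j where "e = E i j" "P i j" "0 \<le> i" "i < j" "j < N"
  using that[of "int (fst e)" "int (snd e)"] edge_eq_E[OF assms] edgesD[OF assms] assms
  by (simp add: P_def)

theorem parallel_paths_jeq:
  assumes "path p" "path q" "hd p = hd q" "last p = last q" "path_weight p = path_weight q"
  shows "p \<approx> q"
proof -
  have "hd p \<in> edges n D" using assms(1) by (cases p) (auto simp: path_iff)
  then obtain i j where ij: "hd p = E i j" "P i j" "i < j" "j < i + N"
    by (rule edge_lift) auto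
  then have base': "P j (i + N)" "j < i + N" "i + N < j + N" by (auto simp: P_commute)
  have "good i j p" "good i j q"
    using path_good[OF ij(2-4)] assms ij(1) by auto
  then consider "normal i j p" "normal i j q" | "normal j (i + N) p" "normal j (i + N) q"
    using normal_unique_opposite[OF ij(2-4)] assms(4) unfolding good_def by metis
  then show ?thesis
    using normal_unique[OF ij(2-4)] normal_unique[OF base'] assms(4,5) by cases blast+
qed

lemma path_exists:
  assumes "e \<in> edges n D" "f \<in> edges n D"
  obtains p where "path p" "hd p = e" "last p = f"
proof -
  obtain i j where ij: "e = E i j" "P i j" "0 \<le> i" "i < j" "j < N"
    using edge_lift[OF assms(1)] .
  obtain a b where ab: "f = E a b" "P a b" "0 \<le> a" "a < b" "b < N"
    using edge_lift[OF assms(2)] .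
  \<comment> \<open>Turn to a side, run along the sides, turn to the target. The shift by
    \<open>N\<close> ensures \<open>i \<le> a + N\<close>, so that the run goes forward.\<close>
  let ?p = "U i j \<odot> XX i (a + N) \<odot> V (a + N) (b + N)"
  have U: "path (U i j)" "hd (U i j) = E i j" "last (U i j) = E i (i + 1)"
    using path_U[of i j] ij by auto
  have XX: "path (XX i (a + N))" "hd (XX i (a + N)) = E i (i + 1)"
    "last (XX i (a + N)) = E a (a + N + 1)"
    using path_XX[of i "a + N"] ij ab by auto
  have V: "path (V a b)" "hd (V a b) = E a (a + N + 1)" "last (V a b) = E a b"
    using path_V[of a b] ab by auto
  have *: "path (XX i (a + N) \<odot> V a b)"
    using XX V by (simp add: path_pcomp)
  from path_not_Nil[OF this]
  have "hd (XX i (a + N) \<odot> V a b) = E i (i + 1)" "last (XX i (a + N) \<odot> V a b) = E a b"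
    using XX V by (simp_all add: hd_pcomp last_pcomp)
  then have p: "path ?p" using U * by (simp add: path_pcomp)
  moreover from path_not_Nil[OF this] have "hd ?p = e" "last ?p = f"
    using U V path_not_Nil[OF *] ij ab by (simp_all add: hd_pcomp last_pcomp)
  ultimately show thesis by (rule that)
qed

end

section \<open>The Jacobian ideal\<close>

lemma rot_path_eq_rotate: "rot_path c i = rotate (Suc i) c"
  by (rule nth_equalityI) (auto simp: rot_path_def nth_rotate simp del: rotate_Suc)

text \<open>A cycle without repeated vertices contains each of its arrows once, so the derivative is
  a single path, obtained by rotating the cycle. For \<open>ys = []\<close> the arrow is the one
  that closes the cycle.\<close>

lemma cyc_deriv_append:
  assumes "distinct (xs @ ys)" "xs \<noteq> []"
  shows "cyc_deriv (last xs, hd (ys @ xs)) (xs @ ys) p = (if p = ys @ xs then 1 else 0)"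
proof -
  let ?c = "xs @ ys" and ?i = "length xs - 1"
  have i: "?i < length ?c" "?c ! ?i = last xs" "Suc ?i = length xs"
    using assms(2) length_greater_0_conv[of xs] by (auto simp: nth_append last_conv_nth simp del: length_greater_0_conv)
  have rot: "rot_path ?c ?i = ys @ xs" 
    by (simp only: rot_path_eq_rotate i(3) rotate_append)
  have hd: "?c ! ((?i + 1) mod length ?c) = hd (ys @ xs)"
  proof (cases ys)
    case Nil
    then show ?thesis using assms(2) i(3) by (simp add: hd_conv_nth)
  next
    case (Cons a list)
    then show ?thesis using i(3) by (simp add: nth_append)
  qed
  have "l < length ?c \<and> (?c ! l, ?c ! ((l + 1) mod length ?c)) = (last xs, hd (ys @ xs)) \<and> rot_path ?c l = p
    \<longleftrightarrow> l = ?i \<and> p = ys @ xs" for l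
  proof (cases "l = ?i")
    case True
    show ?thesis unfolding True rot hd i(2) using i(1) by (simp only: simp_thms) auto
  next
    case False
    then have "?c ! l \<noteq> last xs" if "l < length ?c"
      using nth_eq_iff_index_eq[OF assms(1) that i(1)] i(2) by simp
    then show ?thesis using False by (simp only: prod.inject) blast
  qed
  then have "{l. l < length ?c \<and> (?c ! l, ?c ! ((l + 1) mod length ?c)) = (last xs, hd (ys @ xs)) \<and> rot_path ?c l = p}
    = (if p = ys @ xs then {?i} else {})"
    by (simp only: Collect_conv_if)
  then show ?thesis by (simp add: cyc_deriv_def)
qed

lemma cyc_deriv_outside:
  assumes "e \<notin> set c \<or> f \<notin> set c"
  shows "cyc_deriv (e, f) c p = 0"
proof -
  have "{i. i < length c \<and> (c ! i, c ! ((i + 1) mod length c)) = (e, f) \<and> rot_path c i = p} = {}"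
  proof -
    have "c ! l \<in> set c \<and> c ! ((l + 1) mod length c) \<in> set c" if "l < length c" for l
      using that by (intro conjI nth_mem mod_less_divisor) auto
    then show ?thesis using assms by blast
  qed
  then show ?thesis by (simp only: cyc_deriv_def card.empty) simp
qed

text \<open>The two factors in \<open>pmult\<close> overlap in the entry at position
  \<open>i\<close>, so a factorisation of a list is an instance of \<open>\<odot>\<close> with its
  cut at the last entry of \<open>x\<close>.\<close>

lemma take_drop_eq_iff:
  assumes "i < length p" "x \<noteq> []"
  shows "take (Suc i) p = x \<and> drop i p = y \<longleftrightarrow>
    y \<noteq> [] \<and> last x = hd y \<and> p = x @ tl y \<and> i = length x - 1"
proof
  assume *: "take (Suc i) p = x \<and> drop i p = y"
  then have x: "x = take i p @ [p ! i]" and y: "y = p ! i # drop (Suc i) p"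
    using assms by (auto simp: take_Suc_conv_app_nth Cons_nth_drop_Suc)
  have "p = take i p @ p ! i # drop (Suc i) p"
    using id_take_nth_drop assms(1) by blast
  then show "y \<noteq> [] \<and> last x = hd y \<and> p = x @ tl y \<and> i = length x - 1"
    using assms(1) unfolding x y by simp
next
  assume *: "y \<noteq> [] \<and> last x = hd y \<and> p = x @ tl y \<and> i = length x - 1"
  have "x = butlast x @ [last x]" using assms(2) by simp
  then have "p = butlast x @ y"
    using * by (metis append.assoc append_Cons append_Nil list.collapse)
  then have "drop i p = y" using * by simp
  moreover have "take (Suc i) p = x" using * assms(2) by simp
  ultimately show "take (Suc i) p = x \<and> drop i p = y" by simp
qed

definition path_basis :: "pedge list \<Rightarrow> pedge list \<Rightarrow> 'k::field" where
  "path_basis p = (if p = [] then (\<lambda>_. 0) else pbasis p)"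

lemma path_basis_apply: "path_basis p r = (if p \<noteq> [] \<and> r = p then 1 else 0)"
  by (simp add: path_basis_def pbasis_def)

lemma pmult_path_basis: "pmult (path_basis x) (path_basis y) = path_basis (x \<odot> y)"
proof
  fix p
  show "pmult (path_basis x) (path_basis y) p = (path_basis (x \<odot> y) p :: 'a)"
  proof (cases "x = []")
    case True
    then show ?thesis by (simp add: pmult_def path_basis_apply)
  next
    case False
    have "pmult (path_basis x) (path_basis y) p = (\<Sum>i<length p.
        if y \<noteq> [] \<and> last x = hd y \<and> p = x @ tl y \<and> i = length x - 1 then 1 else (0::'a))"
      unfolding pmult_def
    proof (rule sum.cong)
      fix i assume i: "i \<in> {..<length p}"
      then have "path_basis x (take (Suc i) p) * path_basis y (drop i p) =
        (if take (Suc i) p = x \<and> drop i p = y then 1 else (0::'a))"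
        using False by (auto simp: path_basis_apply)
      then show "path_basis x (take (Suc i) p) * path_basis y (drop i p) =
        (if y \<noteq> [] \<and> last x = hd y \<and> p = x @ tl y \<and> i = length x - 1 then 1 else (0::'a))"
        using take_drop_eq_iff[of i p x y] False i by simp
    qed simp
    also have "\<dots> = path_basis (x \<odot> y) p"
    proof (cases "y \<noteq> [] \<and> last x = hd y \<and> p = x @ tl y")
      case True
      then have "length x - 1 < length p" using False by (cases x) auto
      then show ?thesis using True False by (simp add: path_basis_apply pcomp_def)
    next
      case False
      then show ?thesis by (auto simp: path_basis_apply pcomp_def)
    qed
    finally show ?thesis .
  qed
qed

lemma pmult_diff_right: "pmult f (\<lambda>p. g p - h p) = (\<lambda>p. pmult f g p - pmult f h p)"
  by (rule ext) (simp add: pmult_def right_diff_distrib sum_subtractf)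

lemma pmult_diff_left: "pmult (\<lambda>p. f p - g p) h = (\<lambda>p. pmult f h p - pmult g h p)"
  by (rule ext) (simp add: pmult_def left_diff_distrib sum_subtractf)

lemma path_basis_expansion:
  assumes "finite S" "{p. f p \<noteq> 0} \<subseteq> S" "f [] = 0"
  shows "f p = (\<Sum>q\<in>S. f q * path_basis q p)"
proof -
  have "(\<Sum>q\<in>S. f q * path_basis q p) = (\<Sum>q\<in>S. if q = p then f q else 0)"
    using assms(3) by (intro sum.cong) (auto simp: path_basis_apply)
  also have "\<dots> = f p" using assms by (subst sum.delta) auto
  finally show ?thesis by simp
qed

lemma pmult_expansion:
  assumes "finite A" "{p. f p \<noteq> 0} \<subseteq> A" "f [] = 0" "finite B" "{p. g p \<noteq> 0} \<subseteq> B" "g [] = 0"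
  shows "pmult f g p = (\<Sum>q\<in>A. \<Sum>r\<in>B. f q * g r * path_basis (q \<odot> r) p)"
proof -
  have "pmult f g p = (\<Sum>i<length p. (\<Sum>q\<in>A. f q * path_basis q (take (Suc i) p)) *
      (\<Sum>r\<in>B. g r * path_basis r (drop i p)))"
    unfolding pmult_def
    by (intro sum.cong arg_cong2[where f = "(*)"] path_basis_expansion assms) auto
  also have "\<dots> = (\<Sum>i<length p. \<Sum>q\<in>A. \<Sum>r\<in>B.
      f q * g r * (path_basis q (take (Suc i) p) * path_basis r (drop i p)))"
    unfolding sum_product by (simp add: mult_ac)
  also have "\<dots> = (\<Sum>q\<in>A. \<Sum>i<length p. \<Sum>r\<in>B.
      f q * g r * (path_basis q (take (Suc i) p) * path_basis r (drop i p)))"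
    by (rule sum.swap)
  also have "\<dots> = (\<Sum>q\<in>A. \<Sum>r\<in>B. \<Sum>i<length p.
      f q * g r * (path_basis q (take (Suc i) p) * path_basis r (drop i p)))"
    by (intro sum.cong sum.swap) auto
  also have "\<dots> = (\<Sum>q\<in>A. \<Sum>r\<in>B. f q * g r * pmult (path_basis q) (path_basis r) p)"
    by (simp add: pmult_def sum_distrib_left)
  finally show ?thesis by (simp add: pmult_path_basis)
qed

context triangulated_polygon
begin

section \<open>Generators of the ideal as differences of two paths\<close>

lemma finite_edges: "finite (edges n D)"
proof (rule finite_subset)
  show "edges n D \<subseteq> {..<n} \<times> {..<n}"
    using edgesD by force
qed simp

lemma finite_triangles: "finite (triangles n D)"
proof (rule finite_subset)
  show "triangles n D \<subseteq> {..<n} \<times> {..<n} \<times> {..<n}"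
    by (auto simp: triangles_def is_triangle_def)
qed simp

text \<open>Two sides of a triangle already have all three vertices as ends, so a single triangle
  contributes to the derivative.\<close>

lemma triangle_tri_cycle:
  assumes "triangle i j k"
  obtains t where "t \<in> triangles n D" 
    "\<forall>p. cyc_deriv (E i j, E i k) (tri_cycle t) p = (if p = [E i k, E j k, E i j] then 1 else (0 :: 'k :: field))"
    "\<forall>s \<in> triangles n D - {t}. E i j \<notin> set (tri_cycle s) \<or> E i k \<notin> set (tri_cycle s)"
proof -
  obtain a b c where t: "is_triangle n D a b c" and
    m: "(i mod N, j mod N, k mod N) \<in>
      {(int a, int b, int c), (int b, int c, int a), (int c, int a, int b)}"
    using triangle_sorted[OF assms] .
  have abc: "a < b" "b < c" "c < n" using t by (auto simp: is_triangle_def)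
  have E: "E (int a) (int b) = (a, b)" "E (int b) (int c) = (b, c)" "E (int a) (int c) = (a, c)"
    using abc E_of_nat by auto
  have "(E i j, E i k, E j k) = (E (i mod N) (j mod N), E (i mod N) (k mod N), E (j mod N) (k mod N))"
    by simp
  also have "\<dots> \<in> {((a, b), (a, c), (b, c)), ((b, c), (a, b), (a, c)), ((a, c), (b, c), (a, b))}"
    using m E by (auto simp: E_commute simp del: E_mod)
  finally have e: "(E i j, E i k, E j k) \<in>
    {((a, b), (a, c), (b, c)), ((b, c), (a, b), (a, c)), ((a, c), (b, c), (a, b))}" .
  have 1: "cyc_deriv (E i j, E i k) (tri_cycle (a, b, c)) p = (if p = [E i k, E j k, E i j] then 1 else (0 :: 'k))" for p
    using e cyc_deriv_append[of "[(a, b)]" "[(a, c), (b, c)]" p]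
      cyc_deriv_append[of "[(a, b), (a, c)]" "[(b, c)]" p]
      cyc_deriv_append[of "[(a, b), (a, c), (b, c)]" "[]" p] abc
    by (auto simp: tri_cycle_def)
  have 2: "E i j \<notin> set (tri_cycle s) \<or> E i k \<notin> set (tri_cycle s)"
    if "s \<in> triangles n D" "s \<noteq> (a, b, c)" for s
  proof (rule ccontr)
    assume *: "\<not> ?thesis"
    obtain a' b' c' where s: "s = (a', b', c')" by (cases s) auto
    then have s': "a' < b'" "b' < c'" using that by (auto simp: triangles_def is_triangle_def)
    show False
      using * e s' abc that(2) unfolding s by (auto simp: tri_cycle_def)
  qed
  show thesis
    using that[of "(a, b, c)"] t 1 2 by (simp add: triangles_def)
qed

lemma R_shift_dvd:
  assumes "N dvd c"
  shows "R (i + c) (j + c) (k + c) = R i j k"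
proof -
  have "E (i + c) \<circ> (\<lambda>x. x + c) = E i" "P (i + c) \<circ> (\<lambda>x. x + c) = P i"
    using E_shift_dvd[OF assms] P_shift_dvd[OF assms] by (simp_all add: fun_eq_iff)
  then show ?thesis by (simp add: R_def upto_shift filter_map o_assoc) 
qed

lemma big_cycle_eq:
  assumes "v < n"
  shows "big_cycle n D v = R (int v) (int v + 1) (int v + N - 1)"
proof -
  have "[int v + 1..int v + N - 1] = map (\<lambda>k. int v + int k) [1..<n]"
    by (rule nth_equalityI) (auto simp: nth_upto)
  moreover have "mk_edge v ((v + k) mod n) = E (int v) (int v + int k)" for k
    using assms by (simp add: cyc_edge_def flip: of_nat_add of_nat_mod)
  ultimately show ?thesis
    by (simp add: big_cycle_def R_def filter_map o_def P_def)
qed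

lemma distinct_R:
  assumes "i < j" "k < i + N"
  shows "distinct (R i j k)"
proof -
  have "inj_on (E i) {l. j \<le> l \<and> l \<le> k \<and> P i l}"
  proof (rule inj_onI)
    fix l l' assume *: "l \<in> {l. j \<le> l \<and> l \<le> k \<and> P i l}" "l' \<in> {l. j \<le> l \<and> l \<le> k \<and> P i l}" "E i l = E i l'"
    then have "l mod N = l' mod N" by (auto simp: E_eq_iff)
    then show "l = l'" by (rule mod_eq_window) (use * assms in auto)
  qed
  moreover have "set (filter (P i) [j..k]) = {l. j \<le> l \<and> l \<le> k \<and> P i l}" by auto
  ultimately show ?thesis by (simp add: R_def distinct_map)
qed

text \<open>Cutting at the arrow from \<open>{i, j}\<close> to \<open>{i, k}\<close> leaves the
  rotation from \<open>{i, k}\<close> to the side before \<open>i\<close>, then the one from the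
  side after \<open>i\<close> to \<open>{i, j}\<close>. The external arrow is hidden in the junction
  of the two lists; it is \<open>X i\<close> because of \<open>diag_at i\<close>.\<close>

lemma cyc_deriv_big_cycle:
  assumes t: "triangle i j k" and "diag_at i"
  defines "v \<equiv> nat (i mod N)"
  shows "cyc_deriv (E i j, E i k) (big_cycle n D v) p = (if p = U i k \<odot> V i j then 1 else (0 :: 'k :: field))"
proof -
  have ijk: "i < j" "j < k" "k < i + N" "P i j" "P i k" using t by (auto simp: triangle_def)
  have v: "int v = i mod N" "v < n" using N_ge_3 by (simp_all add: v_def nat_less_iff)
  have dvd: "N dvd int v - i" unfolding v by (metis mod_eq_dvd_iff mod_mod_trivial)
  have "big_cycle n D v = R (i + (int v - i)) (i + 1 + (int v - i)) (i + N - 1 + (int v - i))"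
    using big_cycle_eq[OF v(2)] by (simp add: algebra_simps)
  then have "big_cycle n D v = R i (i + 1) (i + N - 1)"
    by (simp only: R_shift_dvd[OF dvd])
  also have "\<dots> = V i k \<odot> R i k (i + N - 1)"
    using R_split[of i k "i + 1" "i + N - 1"] ijk by (simp add: V_def)
  also have "\<dots> = V i j \<odot> [E i j, E i k] \<odot> R i k (i + N - 1)"
    by (simp add: V_extend_fst[OF t] pcomp_assoc)
  also have "[E i j, E i k] \<odot> R i k (i + N - 1) = E i j # R i k (i + N - 1)"
    using hd_R[of i k "i + N - 1"] ijk R_not_Nil[of i "i + N - 1" k]
    by (cases "R i k (i + N - 1)") (auto simp: pcomp_def)
  also have "V i j \<odot> \<dots> = V i j @ R i k (i + N - 1)"
    using path_V[of i j] ijk by (simp add: pcomp_def)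
  finally have bc: "big_cycle n D v = V i j @ R i k (i + N - 1)" .
  have "U i k \<odot> V i j = R i k (i + N - 1) \<odot> [E (i - 1) i, E i (i + 1)] \<odot> V i j"
    using assms(2) by (simp add: U_def X_def pcomp_assoc)
  also have "[E (i - 1) i, E i (i + 1)] \<odot> V i j = E (i - 1) i # V i j"
    using path_V[of i j] ijk by (cases "V i j") (auto simp: pcomp_def)
  also have "R i k (i + N - 1) \<odot> \<dots> = R i k (i + N - 1) @ V i j"
    using last_R[of i "i + N - 1" k] ijk R_not_Nil[of i "i + N - 1" k] by (simp add: pcomp_def E_commute)
  finally have UV: "U i k \<odot> V i j = R i k (i + N - 1) @ V i j" .
  have "distinct (big_cycle n D v)"
    unfolding \<open>big_cycle n D v = R i (i + 1) (i + N - 1)\<close> by (rule distinct_R) auto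
  moreover have "last (V i j) = E i j" "V i j \<noteq> []" using path_V[of i j] ijk by auto
  moreover have "hd (R i k (i + N - 1) @ V i j) = E i k"
    using hd_R[of i k "i + N - 1"] R_not_Nil[of i "i + N - 1" k] ijk by (simp add: hd_append)
  ultimately show ?thesis
    using cyc_deriv_append[of "V i j" "R i k (i + N - 1)" p] unfolding bc UV by simp
qed

lemma big_cycle_other:
  assumes t: "triangle i j k" and v: "v < n" "E i j \<in> set (big_cycle n D v)" "E i k \<in> set (big_cycle n D v)"
  shows "v = nat (i mod N)"
proof -
  obtain l l' where l: "E i j = E (int v) l" "E i k = E (int v) l'"
    using v(2,3) unfolding big_cycle_eq[OF v(1)] by (auto simp: R_def)
  have "j mod N \<noteq> k mod N"
    using mod_eq_window[of j k] t by (auto simp: triangle_def)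
  then have "i mod N = int v mod N"
    using l unfolding E_eq_iff by auto
  then show ?thesis using v(1) by simp
qed

lemma dW_eq:
  assumes t: "triangle i j k" and d: "diag_at i"
  shows "dW n D (E i j, E i k) =
    (\<lambda>p. path_basis [E i k, E j k, E i j] p - path_basis (U i k \<odot> V i j) p :: 'k :: field)"
proof
  fix p
  obtain t0 where t0: "t0 \<in> triangles n D" 
    "\<forall>p. cyc_deriv (E i j, E i k) (tri_cycle t0) p = (if p = [E i k, E j k, E i j] then 1 else (0 :: 'k))"
    "\<forall>s \<in> triangles n D - {t0}. E i j \<notin> set (tri_cycle s) \<or> E i k \<notin> set (tri_cycle s)"
    by (rule triangle_tri_cycle[OF t, where 'k = 'k])
  have "(\<Sum>t\<in>triangles n D. cyc_deriv (E i j, E i k) (tri_cycle t) p) =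
      (\<Sum>t\<in>{t0}. cyc_deriv (E i j, E i k) (tri_cycle t) p :: 'k)"
    using t0(1,3) finite_triangles cyc_deriv_outside by (intro sum.mono_neutral_right) blast+
  then have 1: "(\<Sum>t\<in>triangles n D. cyc_deriv (E i j, E i k) (tri_cycle t) p) =
      (path_basis [E i k, E j k, E i j] p :: 'k)"
    by (simp add: t0(2) path_basis_apply)
  let ?v = "nat (i mod N)"
  have v: "?v < n" "has_diag D ?v" using d N_ge_3 by (simp_all add: diag_at_def nat_less_iff)
  have "cyc_deriv (E i j, E i k) (big_cycle n D v) p = (0 :: 'k)" if "v < n" "v \<noteq> ?v" for v
    using big_cycle_other[OF t that(1)] that(2) by (intro cyc_deriv_outside) auto
  then have "(\<Sum>v\<in>{v. v < n \<and> has_diag D v}. cyc_deriv (E i j, E i k) (big_cycle n D v) p) =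
      (\<Sum>v\<in>{?v}. cyc_deriv (E i j, E i k) (big_cycle n D v) p :: 'k)"
    using v by (intro sum.mono_neutral_right) auto
  then have 2: "(\<Sum>v\<in>{v. v < n \<and> has_diag D v}. cyc_deriv (E i j, E i k) (big_cycle n D v) p) =
      (path_basis (U i k \<odot> V i j) p :: 'k)"
    using path_UV(4)[OF t] by (simp add: cyc_deriv_big_cycle[OF t d] path_basis_apply)
  show "dW n D (E i j, E i k) p =
    (path_basis [E i k, E j k, E i j] p - path_basis (U i k \<odot> V i j) p :: 'k)"
    unfolding dW_def 1 2 ..
qed

text \<open>External arrows join two sides, and so does the internal arrow at an ear. The remaining
  arrows are exactly those for which \<open>jeq\<close> has a relation.\<close>

lemma unfrozen_arrowE:
  assumes "a \<in> arrows n D" "fst a \<notin> sides n \<or> snd a \<notin> sides n"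
  obtains i j k where "triangle i j k" "diag_at i" "a = (E i j, E i k)"
proof -
  obtain e f where a: "a = (e, f)" by (cases a)
  have "\<not> external_arrow n D e f"
  proof
    assume "external_arrow n D e f"
    then obtain i where i: "e = E (i - 1) i" "f = E i (i + 1)"
      by (auto simp: external_arrow_iff)
    then show False
      using is_side_E[of "i - 1" i] is_side_E[of i "i + 1"] N_ge_3 assms(2) a by (auto simp: sides_def)
  qed
  then have "internal_arrow n D e f" using assms(1) a by (simp add: arrows_def)
  then obtain i j k where t: "triangle i j k" "e = E i j" "f = E i k"
    by (rule internal_arrowE)
  then have ijk: "i < j" "j < k" "k < i + N" "P i j" "P i k" by (auto simp: triangle_def)
  have "(j \<noteq> i + 1 \<and> j \<noteq> i + N - 1) \<or> (k \<noteq> i + 1 \<and> k \<noteq> i + N - 1)"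
    using is_side_E[of i j] is_side_E[of i k] assms(2) ijk t a by (auto simp: sides_def)
  then have "diag_at i"
  proof
    assume "j \<noteq> i + 1 \<and> j \<noteq> i + N - 1"
    then show ?thesis unfolding diag_at_iff by (intro exI[of _ j]) (use ijk in auto)
  next
    assume "k \<noteq> i + 1 \<and> k \<noteq> i + N - 1"
    then show ?thesis unfolding diag_at_iff by (intro exI[of _ k]) (use ijk in auto)
  qed
  then show thesis using that t a by blast
qed

lemma generator_eq:
  assumes "triangle i j k" "diag_at i" "p \<noteq> []" "q \<noteq> []"
  shows "pmult (pmult (pbasis p) (dW n D (E i j, E i k))) (pbasis q) =
    (\<lambda>r. path_basis (p \<odot> [E i k, E j k, E i j] \<odot> q) r - path_basis (p \<odot> (U i k \<odot> V i j) \<odot> q) r :: 'k :: field)"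
proof -
  have b: "pbasis p = (path_basis p :: _ \<Rightarrow> 'k)" "pbasis q = (path_basis q :: _ \<Rightarrow> 'k)"
    using assms(3,4) by (simp_all add: path_basis_def)
  show ?thesis
    unfolding b dW_eq[OF assms(1,2)] pmult_diff_right pmult_diff_left pmult_path_basis pcomp_assoc ..
qed

lemma jac_ideal_sum:
  assumes "finite S" "\<And>s. s \<in> S \<Longrightarrow> f s \<in> jac_ideal n D"
  shows "(\<lambda>p. \<Sum>s\<in>S. c s * f s p) \<in> jac_ideal n D"
  using assms
proof (induction S)
  case empty
  then show ?case by (simp add: jac_ideal.zero)
next
  case (insert s S)
  have "(\<lambda>p. \<Sum>s\<in>insert s S. c s * f s p) = padd (psmult (c s) (f s)) (\<lambda>p. \<Sum>s\<in>S. c s * f s p)"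
    using insert.hyps by (simp add: padd_def psmult_def fun_eq_iff)
  then show ?case
    using insert by (simp add: jac_ideal.add jac_ideal.smult)
qed

text \<open>Congruent lists are paths together, so \<open>path p\<close> passes through the
  induction and provides the path contexts that \<open>gen\<close> demands.\<close>

lemma jeq_jac_ideal:
  assumes "p \<approx> q" "path p"
  shows "(\<lambda>r. path_basis p r - path_basis q r :: 'k :: field) \<in> jac_ideal n D"
  using assms
proof (induction rule: jeq.induct)
  case (jeq_refl p)
  then show ?case by (simp add: jac_ideal.zero)
next
  case (jeq_rel i j k x y)
  have ijk: "i < j" "j < k" "k < i + N" "P i j" "P i k" using jeq_rel(1) by (auto simp: triangle_def)
  have paths: "path x" "path y" using jeq_rel(3) by (auto simp: path_pcomp)
  have "(E i j, E i k) \<in> arrows n D" by (rule arrow_fst[OF jeq_rel(1)])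
  moreover have "E i j \<notin> sides n \<or> E i k \<notin> sides n"
    using diag_at_triangle[OF jeq_rel(1,2)] is_side_E[of i j] is_side_E[of i k] ijk by (auto simp: sides_def)
  ultimately have "pmult (pmult (pbasis x) (dW n D (E i j, E i k))) (pbasis y) \<in> (jac_ideal n D :: (_ \<Rightarrow> 'k) set)"
    using paths by (intro jac_ideal.gen) auto
  then show ?case
    unfolding generator_eq[OF jeq_rel(1,2) path_not_Nil[OF paths(1)] path_not_Nil[OF paths(2)]] .
next
  case (jeq_sym p q)
  then have "path p" using jeq_invariants(4) by blast
  then have "psmult (- 1) (\<lambda>r. path_basis p r - path_basis q r :: 'k) \<in> jac_ideal n D"
    using jeq_sym by (intro jac_ideal.smult) auto
  moreover have "psmult (- 1) (\<lambda>r. path_basis p r - path_basis q r :: 'k) = (\<lambda>r. path_basis q r - path_basis p r)"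
    by (simp add: psmult_def fun_eq_iff)
  ultimately show ?case by simp
next
  case (jeq_trans p q r)
  then have "path q" using jeq_invariants(4) by blast
  then have "padd (\<lambda>s. path_basis p s - path_basis q s) (\<lambda>s. path_basis q s - path_basis r s :: 'k) \<in> jac_ideal n D"
    using jeq_trans by (intro jac_ideal.add) auto
  moreover have "padd (\<lambda>s. path_basis p s - path_basis q s) (\<lambda>s. path_basis q s - path_basis r s :: 'k) =
    (\<lambda>s. path_basis p s - path_basis r s)"
    by (simp add: padd_def fun_eq_iff)
  ultimately show ?case by simp
qed

end

section \<open>The tiled order\<close>

definition path_term :: "pedge \<Rightarrow> pedge \<Rightarrow> pedge list \<Rightarrow> 'k::field poly" where
  "path_term e g p = (if p \<noteq> [] \<and> hd p = e \<and> last p = g then monom 1 (path_weight p) else 0)"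

definition entry :: "(pedge list \<Rightarrow> 'k::field) \<Rightarrow> pedge \<Rightarrow> pedge \<Rightarrow> 'k poly" where
  "entry f e g = (\<Sum>p | f p \<noteq> 0. smult (f p) (path_term e g p))"

lemma entry_superset:
  assumes "finite S" "{p. f p \<noteq> 0} \<subseteq> S"
  shows "entry f e g = (\<Sum>p\<in>S. smult (f p) (path_term e g p))"
  unfolding entry_def by (rule sum.mono_neutral_left) (use assms in auto)

lemma coeff_entry:
  "coeff (entry f e g) k =
    (\<Sum>p | f p \<noteq> 0. if p \<noteq> [] \<and> hd p = e \<and> last p = g \<and> path_weight p = k then f p else 0)"
  unfolding entry_def coeff_sum by (intro sum.cong) (auto simp: path_term_def)

lemma path_term_pcomp:
  assumes "finite A" "q \<noteq> []" "last q \<in> A"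
  shows "path_term e g (q \<odot> r) = (\<Sum>h\<in>A. path_term e h q * path_term h g r :: 'k::field poly)"
proof -
  have "(\<Sum>h\<in>A. path_term e h q * path_term h g r :: 'k poly) =
    (\<Sum>h\<in>A. if last q = h then path_term e (last q) q * path_term (last q) g r else 0)"
    by (intro sum.cong) (auto simp: path_term_def)
  also have "\<dots> = path_term e (last q) q * path_term (last q) g r"
    using assms by simp
  also have "\<dots> = path_term e g (q \<odot> r)"
    using assms(2) hd_pcomp[of q r] last_pcomp[of q r] path_weight_pcomp[of q r] pcomp_eq_Nil[of q r]
    by (auto simp: path_term_def mult_monom)
  finally show ?thesis by simp
qed

lemma smult_sum_right: "smult c (\<Sum>s\<in>S. h s) = (\<Sum>s\<in>S. smult c (h s))"
  by (induction S rule: infinite_finite_induct) (auto simp: smult_add_right)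

lemma fpoly_add: "fpoly (p + q) = fpoly p + fpoly q"
  by (simp add: fpoly_def)

lemma fpoly_mult: "fpoly (p * q) = fpoly p * fpoly q"
  by (simp add: fpoly_def)

lemma fpoly_0 [simp]: "fpoly 0 = 0"
  by (simp add: fpoly_def Zero_fract_def)

lemma fpoly_1 [simp]: "fpoly 1 = 1"
  by (simp add: fpoly_def One_fract_def)

lemma fpoly_sum: "fpoly (\<Sum>s\<in>S. h s) = (\<Sum>s\<in>S. fpoly (h s))"
  by (induction S rule: infinite_finite_induct) (auto simp: fpoly_add)

lemma fpoly_power: "fpoly (p ^ k) = fpoly p ^ k"
  by (induction k) (auto simp: fpoly_mult)

lemma fpoly_eq_0_iff: "fpoly p = 0 \<longleftrightarrow> p = 0"
  by (simp add: fpoly_def Zero_fract_def eq_fract)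

text \<open>Minimal weights are natural numbers, so this covers every exponent of the tiled order
  and keeps all entries polynomial.\<close>

lemma xpowR_nat: "xpowR (int k) = {fpoly (p * monom 1 k) | p. True}"
proof -
  have *: "monom 1 k = [:0, 1 :: 'a:] ^ k" by (simp add: monom_altdef)
  show ?thesis unfolding xpowR_def fpoly_mult fpoly_power * by simp
qed

context triangulated_polygon
begin

section \<open>The homomorphism and its kernel\<close>

lemma path_algD:
  assumes "f \<in> path_alg n D"
  shows "finite {p. f p \<noteq> 0}" "f p \<noteq> 0 \<Longrightarrow> path p" "f [] = 0"
proof -
  show "finite {p. f p \<noteq> 0}" "f p \<noteq> 0 \<Longrightarrow> path p"
    using assms by (auto simp: path_alg_def)
  show "f [] = 0" using assms by (auto simp: path_alg_def qpaths_def)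
qed

lemma path_ends: 
  assumes "path p"
  shows "hd p \<in> edges n D" "last p \<in> edges n D"
  using assms hd_in_set[of p] last_in_set[of p] by (auto simp: path_iff)

lemma entry_padd:
  assumes "f \<in> path_alg n D" "g \<in> path_alg n D"
  shows "entry (padd f g) e h = entry f e h + entry g e h"
proof -
  let ?S = "{p. f p \<noteq> 0} \<union> {p. g p \<noteq> 0}"
  have S: "finite ?S" using path_algD(1) assms by auto
  have "entry k e h = (\<Sum>p\<in>?S. smult (k p) (path_term e h p))"
    if "k = f \<or> k = g \<or> k = padd f g" for k
    by (rule entry_superset[OF S]) (use that in \<open>auto simp: padd_def\<close>)
  then show ?thesis by (simp add: padd_def smult_add_left sum.distrib)
qed

lemma entry_psmult:
  assumes "f \<in> path_alg n D"
  shows "entry (psmult c f) e h = smult c (entry f e h)"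
proof -
  have "entry (psmult c f) e h = (\<Sum>p | f p \<noteq> 0. smult (psmult c f p) (path_term e h p))"
    by (rule entry_superset) (use path_algD(1)[OF assms] in \<open>auto simp: psmult_def\<close>)
  then show ?thesis
    by (simp add: entry_def psmult_def smult_sum_right)
qed

lemma entry_path_basis_diff:
  assumes "p = [] \<longleftrightarrow> q = []" "hd p = hd q" "last p = last q" "path_weight p = path_weight q"
  shows "entry (\<lambda>r. path_basis p r - path_basis q r) e h = 0"
proof -
  have "path_term e h p = path_term e h q" using assms by (simp add: path_term_def)
  moreover have "entry (\<lambda>r. path_basis p r - path_basis q r) e h =
    (\<Sum>r\<in>{p, q}. smult (path_basis p r - path_basis q r) (path_term e h r))"
    by (rule entry_superset) (auto simp: path_basis_apply split: if_splits)
  ultimately show ?thesis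
    using assms(1) by (cases "p = q") (auto simp: path_basis_apply)
qed

lemma entry_pmult:
  fixes f g :: "pedge list \<Rightarrow> 'k::field"
  assumes "f \<in> path_alg n D" "g \<in> path_alg n D"
  shows "entry (pmult f g) e h = (\<Sum>l\<in>edges n D. entry f e l * entry g l h)"
proof -
  let ?A = "{p. f p \<noteq> 0}" and ?B = "{p. g p \<noteq> 0}"
  \<comment> \<open>All compositions of support elements, possibly including \<open>[]\<close>, on
    which \<open>path_term\<close> vanishes.\<close>
  let ?S = "(\<lambda>(q, r). q \<odot> r) ` (?A \<times> ?B)"
  have fin: "finite ?A" "finite ?B" using path_algD(1) assms by auto
  have exp: "pmult f g p = (\<Sum>q\<in>?A. \<Sum>r\<in>?B. f q * g r * path_basis (q \<odot> r) p)" for p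
    by (rule pmult_expansion) (use assms path_algD in auto)
  have "{p. pmult f g p \<noteq> 0} \<subseteq> ?S"
  proof
    fix p assume "p \<in> {p. pmult f g p \<noteq> 0}"
    then obtain q where q: "q \<in> ?A" "(\<Sum>r\<in>?B. f q * g r * path_basis (q \<odot> r) p) \<noteq> 0"
      unfolding exp using sum.not_neutral_contains_not_neutral by force
    then obtain r where r: "r \<in> ?B" "f q * g r * path_basis (q \<odot> r) p \<noteq> 0"
      using sum.not_neutral_contains_not_neutral by force
    then have "p = q \<odot> r" by (auto simp: path_basis_apply split: if_splits)
    then show "p \<in> ?S" using q r by blast
  qed
  then have "entry (pmult f g) e h = (\<Sum>p\<in>?S. smult (pmult f g p) (path_term e h p))"
    using fin by (intro entry_superset) auto
  also have "\<dots> = (\<Sum>p\<in>?S. \<Sum>q\<in>?A. \<Sum>r\<in>?B. smult (f q * g r * path_basis (q \<odot> r) p) (path_term e h p))"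
    unfolding exp by (simp add: smult_sum)
  also have "\<dots> = (\<Sum>q\<in>?A. \<Sum>p\<in>?S. \<Sum>r\<in>?B. smult (f q * g r * path_basis (q \<odot> r) p) (path_term e h p))"
    by (rule sum.swap)
  also have "\<dots> = (\<Sum>q\<in>?A. \<Sum>r\<in>?B. \<Sum>p\<in>?S. smult (f q * g r * path_basis (q \<odot> r) p) (path_term e h p))"
    by (rule sum.cong[OF refl], rule sum.swap)
  also have "\<dots> = (\<Sum>q\<in>?A. \<Sum>r\<in>?B. smult (f q * g r) (path_term e h (q \<odot> r)))"
  proof (intro sum.cong refl)
    fix q r assume qr: "q \<in> ?A" "r \<in> ?B"
    have "(\<Sum>p\<in>?S. smult (f q * g r * path_basis (q \<odot> r) p) (path_term e h p)) =
      (\<Sum>p\<in>?S. if q \<odot> r = p then smult (f q * g r) (path_term e h (q \<odot> r)) else 0)"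
      by (intro sum.cong) (auto simp: path_basis_apply path_term_def)
    also have "\<dots> = smult (f q * g r) (path_term e h (q \<odot> r))"
      using qr fin by (subst sum.delta') auto
    finally show "(\<Sum>p\<in>?S. smult (f q * g r * path_basis (q \<odot> r) p) (path_term e h p)) =
      smult (f q * g r) (path_term e h (q \<odot> r))" .
  qed
  also have "\<dots> = (\<Sum>q\<in>?A. \<Sum>r\<in>?B. \<Sum>l\<in>edges n D.
      smult (f q) (path_term e l q) * smult (g r) (path_term l h r))"
  proof (intro sum.cong refl)
    fix q r assume qr: "q \<in> ?A" "r \<in> ?B"
    then have "path q" using path_algD(2)[OF assms(1)] by simp
    then have "path_term e h (q \<odot> r) = (\<Sum>l\<in>edges n D. path_term e l q * path_term l h r :: 'k poly)"
      by (intro path_term_pcomp finite_edges path_ends path_not_Nil)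
    then show "smult (f q * g r) (path_term e h (q \<odot> r)) =
      (\<Sum>l\<in>edges n D. smult (f q) (path_term e l q) * smult (g r) (path_term l h r))"
      by (simp add: smult_sum_right mult.commute)
  qed
  also have "\<dots> = (\<Sum>q\<in>?A. \<Sum>l\<in>edges n D. \<Sum>r\<in>?B.
      smult (f q) (path_term e l q) * smult (g r) (path_term l h r))"
    by (rule sum.cong[OF refl], rule sum.swap)
  also have "\<dots> = (\<Sum>l\<in>edges n D. \<Sum>q\<in>?A. \<Sum>r\<in>?B.
      smult (f q) (path_term e l q) * smult (g r) (path_term l h r))"
    by (rule sum.swap)
  also have "\<dots> = (\<Sum>l\<in>edges n D. entry f e l * entry g l h)"
    unfolding entry_def sum_product ..
  finally show ?thesis .
qed

lemma entry_pone:
  assumes "e \<in> edges n D"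
  shows "entry (pone n D) e h = (if e = h then 1 else (0 :: 'k :: field poly))"
proof -
  let ?S = "(\<lambda>v. [v]) ` edges n D"
  have "entry (pone n D) e h = (\<Sum>p\<in>?S. smult (pone n D p :: 'k) (path_term e h p))"
    by (rule entry_superset) (auto simp: pone_def finite_edges split: if_splits)
  also have "\<dots> = (\<Sum>v\<in>edges n D. smult (pone n D [v]) (path_term e h [v]))"
    by (subst sum.reindex) (auto simp: inj_on_def)
  also have "\<dots> = (\<Sum>v\<in>edges n D. if e = v then if e = h then 1 else 0 else 0)"
    by (intro sum.cong) (auto simp: pone_def path_term_def)
  also have "\<dots> = (if e = h then 1 else 0)"
    using assms finite_edges by simp
  finally show ?thesis .
qed

lemma path_basis_diff_path_alg:
  assumes "path p \<or> p = []" "path q \<or> q = []"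
  shows "(\<lambda>r. path_basis p r - path_basis q r) \<in> path_alg n D"
proof -
  have "{r. path_basis p r - path_basis q r \<noteq> (0 :: 'a)} \<subseteq> {p, q} - {[]}"
    by (auto simp: path_basis_apply split: if_splits)
  then show ?thesis
    using assms finite_subset[of _ "{p, q} - {[]}"] unfolding path_alg_def by auto
qed

lemma jac_ideal_entry:
  assumes "f \<in> jac_ideal n D"
  shows "f \<in> path_alg n D \<and> (\<forall>e h. entry f e h = 0)"
  using assms
proof induction
  case zero
  then show ?case by (simp add: path_alg_def entry_def)
next
  case (gen a p q)
  obtain i j k where a: "triangle i j k" "diag_at i" "a = (E i j, E i k)"
    using unfrozen_arrowE gen(1,2) by metis
  let ?u = "p \<odot> [E i k, E j k, E i j] \<odot> q" and ?w = "p \<odot> (U i k \<odot> V i j) \<odot> q"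
  have "?u \<approx> ?w" by (rule jeq_rel[OF a(1,2)])
  note inv = jeq_invariants[OF this]
  \<comment> \<open>The contexts of a generator need not be composable with the relation; in that
    case both lists are empty and the generator is zero.\<close>
  have "path ?u \<or> ?u = []"
    using gen(3,4) triangle_path[OF a(1)] hd_pcomp[of "[E i k, E j k, E i j]" q]
    by (auto simp: path_pcomp pcomp_eq_Nil)
  then have "path ?u \<or> ?u = []" "path ?w \<or> ?w = []" using inv by blast+
  then show ?case
    unfolding a(3) generator_eq[OF a(1,2) path_not_Nil[OF gen(3)] path_not_Nil[OF gen(4)]]
    using path_basis_diff_path_alg entry_path_basis_diff[OF inv(5) inv(1-3)] by blast
next
  case (add f g)
  have "{p. padd f g p \<noteq> 0} \<subseteq> {p. f p \<noteq> 0} \<union> {p. g p \<noteq> 0}" by (auto simp: padd_def)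
  then have "padd f g \<in> path_alg n D"
    using add finite_subset unfolding path_alg_def by blast
  then show ?case using add entry_padd by (metis add_0)
next
  case (smult f c)
  have "{p. psmult c f p \<noteq> 0} \<subseteq> {p. f p \<noteq> 0}" by (auto simp: psmult_def)
  then have "psmult c f \<in> path_alg n D"
    using smult finite_subset unfolding path_alg_def by blast
  then show ?case using smult entry_psmult by (metis smult_0_right)
qed

text \<open>Modulo the ideal each path can be replaced by a representative of its class of equal
  ends and weight. Different classes contribute to different entries or to different powers of
  \<open>x\<close>, so vanishing entries make all collected coefficients vanish.\<close>

lemma entry_zero_jac_ideal:
  assumes f: "f \<in> path_alg n D" and zero: "\<And>e h. e \<in> edges n D \<Longrightarrow> h \<in> edges n D \<Longrightarrow> entry f e h = 0"
  shows "f \<in> jac_ideal n D"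
proof -
  let ?A = "{p. f p \<noteq> 0}"
  define key where "key p = (hd p, last p, path_weight p)" for p
  define rep where "rep p = (SOME q. path q \<and> key q = key p)" for p
  have rep: "path (rep p) \<and> key (rep p) = key p" if "path p" for p
    unfolding rep_def by (rule someI[of _ p]) (use that in simp)
  have rep_eq: "rep p = rep q \<longleftrightarrow> key p = key q" if "path p" "path q" for p q
  proof
    assume "rep p = rep q" then show "key p = key q" using rep that by metis
  qed (simp add: rep_def)
  have fin: "finite ?A" and paths: "\<And>p. p \<in> ?A \<Longrightarrow> path p"
    using path_algD[OF f] by auto
  have zero_rep: "(\<Sum>p\<in>?A. f p * path_basis (rep p) r) = 0" for r
  proof (cases "\<exists>p0\<in>?A. rep p0 = r")
    case False
    then show ?thesis by (intro sum.neutral) (auto simp: path_basis_apply)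
  next
    case True
    then obtain p0 where p0: "p0 \<in> ?A" "rep p0 = r" by blast
    have "(\<Sum>p\<in>?A. f p * path_basis (rep p) r) = 
      (\<Sum>p\<in>?A. if p \<noteq> [] \<and> hd p = hd p0 \<and> last p = last p0 \<and> path_weight p = path_weight p0 then f p else 0)"
    proof (rule sum.cong)
      fix p assume p: "p \<in> ?A"
      have "rep p = r \<longleftrightarrow> key p = key p0"
        using rep_eq[OF paths[OF p] paths[OF p0(1)]] p0(2) by simp
      moreover have "rep p \<noteq> []" "p \<noteq> []"
        using rep[OF paths[OF p]] paths[OF p] path_not_Nil by auto
      ultimately show "f p * path_basis (rep p) r =
        (if p \<noteq> [] \<and> hd p = hd p0 \<and> last p = last p0 \<and> path_weight p = path_weight p0 then f p else 0)"
        by (auto simp: path_basis_apply key_def)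
    qed simp
    also have "\<dots> = coeff (entry f (hd p0) (last p0)) (path_weight p0)"
      by (simp add: coeff_entry)
    also have "\<dots> = 0" using zero path_ends paths p0 by simp
    finally show ?thesis .
  qed
  have in_ideal: "(\<lambda>r. \<Sum>p\<in>?A. f p * (path_basis p r - path_basis (rep p) r)) \<in> jac_ideal n D"
  proof (rule jac_ideal_sum[OF fin])
    fix p assume "p \<in> ?A"
    then have "path p" using paths by blast
    then have "p \<approx> rep p" using rep[of p] by (intro parallel_paths_jeq) (auto simp: key_def)
    then show "(\<lambda>r. path_basis p r - path_basis (rep p) r) \<in> jac_ideal n D"
      using \<open>path p\<close> by (rule jeq_jac_ideal)
  qed
  have "f = (\<lambda>r. \<Sum>p\<in>?A. f p * (path_basis p r - path_basis (rep p) r))"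
  proof
    fix r
    have "f r = (\<Sum>p\<in>?A. f p * path_basis p r)"
      by (rule path_basis_expansion) (use fin path_algD(3)[OF f] in auto)
    then show "f r = (\<Sum>p\<in>?A. f p * (path_basis p r - path_basis (rep p) r))"
      using zero_rep[of r] by (simp add: right_diff_distrib sum_subtractf)
  qed
  from subst[OF this[symmetric], of "\<lambda>g. g \<in> jac_ideal n D", OF in_ideal] show ?thesis .
qed

section \<open>Minimal weights as exponents, and surjectivity\<close>

definition min_weight :: "pedge \<Rightarrow> pedge \<Rightarrow> nat" where
  "min_weight e h = (LEAST d. \<exists>p. path p \<and> hd p = e \<and> last p = h \<and> path_weight p = d)"

lemma min_weight_le: "path p \<Longrightarrow> min_weight (hd p) (last p) \<le> path_weight p"
  unfolding min_weight_def by (rule Least_le) blast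

text \<open>Each full turn put in front raises the weight by one, so every weight from the minimum
  on occurs. This is why an entry ranges over a full power of \<open>x\<close> times
  \<open>R\<close>.\<close>

lemma path_of_weight:
  assumes "e \<in> edges n D" "h \<in> edges n D"
  obtains p where "path p" "hd p = e" "last p = h" "path_weight p = min_weight e h + d"
proof -
  obtain q where "path q" "hd q = e" "last q = h"
    using path_exists[OF assms] .
  then have "\<exists>p. path p \<and> hd p = e \<and> last p = h \<and> path_weight p = path_weight q" by blast
  from LeastI[of "\<lambda>d. \<exists>p. path p \<and> hd p = e \<and> last p = h \<and> path_weight p = d", OF this]
  obtain p where p: "path p" "hd p = e" "last p = h" "path_weight p = min_weight e h"
    unfolding min_weight_def by blast
  obtain i j where ij: "e = E i j" "P i j" "0 \<le> i" "i < j" "j < N"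
    using edge_lift[OF assms(1)] .
  show thesis
    using path_pow_T[of i j p d] ij p that by (simp add: add.commute)
qed

lemma min_weight_triangle:
  assumes "e \<in> edges n D" "h \<in> edges n D" "l \<in> edges n D"
  shows "min_weight e l \<le> min_weight e h + min_weight h l"
proof -
  obtain p where p: "path p" "hd p = e" "last p = h" "path_weight p = min_weight e h"
    using path_of_weight[OF assms(1,2), of 0] by auto
  obtain q where q: "path q" "hd q = h" "last q = l" "path_weight q = min_weight h l"
    using path_of_weight[OF assms(2,3), of 0] by auto
  have pq: "path (p \<odot> q)" using p q by (simp add: path_pcomp)
  then show ?thesis
    using min_weight_le[OF pq] path_not_Nil[OF pq] p q
    by (simp add: hd_pcomp last_pcomp path_weight_pcomp)
qed

lemma entry_min_weight:
  assumes "f \<in> path_alg n D"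
  obtains q where "entry f e h = q * monom 1 (min_weight e h)"
proof -
  have "monom 1 (min_weight e h) dvd smult (f p) (path_term e h p)" if "f p \<noteq> 0" for p
  proof (cases "hd p = e \<and> last p = h")
    case True
    then have "min_weight e h \<le> path_weight p" using min_weight_le path_algD(2)[OF assms that] by blast
    then have "monom (f p) (path_weight p) = monom 1 (min_weight e h) * monom (f p) (path_weight p - min_weight e h)"
      by (simp add: mult_monom)
    then show ?thesis using True by (simp add: path_term_def smult_monom)
  qed (auto simp: path_term_def)
  then have "monom 1 (min_weight e h) dvd entry f e h"
    unfolding entry_def by (intro dvd_sum) auto
  then show thesis using that by (metis dvdE mult.commute)
qed

lemma entry_surjective:
  fixes q :: "pedge \<Rightarrow> pedge \<Rightarrow> 'k :: field poly"
  obtains f where "f \<in> path_alg n D"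
    "\<And>e h. e \<in> edges n D \<Longrightarrow> h \<in> edges n D \<Longrightarrow> entry f e h = q e h * monom 1 (min_weight e h)"
proof -
  have "\<exists>p. path p \<and> hd p = e \<and> last p = h \<and> path_weight p = min_weight e h + d"
    if "e \<in> edges n D" "h \<in> edges n D" for e h d
    using path_of_weight[OF that] by metis
  then obtain pt where pt: "\<And>e h d. e \<in> edges n D \<Longrightarrow> h \<in> edges n D \<Longrightarrow>
    path (pt e h d) \<and> hd (pt e h d) = e \<and> last (pt e h d) = h \<and> path_weight (pt e h d) = min_weight e h + d"
    by metis
  \<comment> \<open>The coefficient of \<open>x\<close> to the power \<open>d\<close> in
    \<open>q e h\<close> is to be placed on the chosen path \<open>pt e h d\<close>. As
    \<open>f\<close> takes a path as argument, \<open>e\<close>, \<open>h\<close> and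
    \<open>d\<close> are read off from it, and the test \<open>p = pt ...\<close> rejects other
    paths with the same data.\<close>
  define excess where "excess p = path_weight p - min_weight (hd p) (last p)" for p
  define f where "f p = (if path p \<and> p = pt (hd p) (last p) (excess p)
    then coeff (q (hd p) (last p)) (excess p) else 0)" for p
  have supp: "{p. f p \<noteq> 0} \<subseteq> (\<Union>e\<in>edges n D. \<Union>h\<in>edges n D. pt e h ` {..degree (q e h)})"
  proof
    fix p assume "p \<in> {p. f p \<noteq> 0}"
    then have p: "path p" "p = pt (hd p) (last p) (excess p)" "coeff (q (hd p) (last p)) (excess p) \<noteq> 0"
      by (auto simp: f_def split: if_splits)
    then have "excess p \<le> degree (q (hd p) (last p))" by (intro le_degree)
    then show "p \<in> (\<Union>e\<in>edges n D. \<Union>h\<in>edges n D. pt e h ` {..degree (q e h)})"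
      using p(2) path_ends[OF p(1)] by blast
  qed
  have fin: "finite {p. f p \<noteq> 0}"
    by (rule finite_subset[OF supp]) (use finite_edges in auto)
  have "f \<in> path_alg n D"
    using fin by (auto simp: path_alg_def f_def split: if_splits)
  moreover have "entry f e h = q e h * monom 1 (min_weight e h)"
    if eh: "e \<in> edges n D" "h \<in> edges n D" for e h
  proof (rule poly_eqI)
    fix k
    \<comment> \<open>For \<open>k\<close> below the minimal weight the truncated difference is
      \<open>0\<close> and this path has the wrong weight; the test
      \<open>min_weight e h \<le> k\<close> discards it.\<close>
    let ?p = "pt e h (k - min_weight e h)"
    let ?Q = "\<lambda>p. p \<noteq> [] \<and> hd p = e \<and> last p = h \<and> path_weight p = k"
    have p: "path ?p" "hd ?p = e" "last ?p = h" "path_weight ?p = min_weight e h + (k - min_weight e h)"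
      using pt[OF eh] by auto
    have unique: "p = ?p \<and> min_weight e h \<le> k" if "f p \<noteq> 0" "?Q p" for p
    proof -
      have *: "path p" "p = pt (hd p) (last p) (excess p)" using that(1) by (auto simp: f_def split: if_splits)
      moreover have "excess p = k - min_weight e h" using that(2) by (simp add: excess_def)
      ultimately show ?thesis using that(2) min_weight_le[OF *(1)] by simp
    qed
    have "coeff (entry f e h) k = (\<Sum>p | f p \<noteq> 0. if ?Q p then f p else 0)"
      by (rule coeff_entry)
    also have "\<dots> = (\<Sum>p | f p \<noteq> 0. if ?p = p then if min_weight e h \<le> k then f p else 0 else 0)"
    proof (rule sum.cong)
      fix p assume "p \<in> {p. f p \<noteq> 0}"
      then show "(if ?Q p then f p else 0) = (if ?p = p then if min_weight e h \<le> k then f p else 0 else 0)"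
        using unique[of p] p path_not_Nil[OF p(1)] min_weight_le[OF p(1)] by auto
    qed simp
    also have "\<dots> = (if min_weight e h \<le> k then f ?p else 0)"
      using fin by simp
    also have "\<dots> = coeff (monom 1 (min_weight e h) * q e h) k"
      using p by (simp add: coeff_monom_mult f_def excess_def)
    finally show "coeff (entry f e h) k = coeff (q e h * monom 1 (min_weight e h)) k"
      by (simp add: mult.commute)
  qed
  ultimately show thesis using that by blast
qed

theorem jac_tiled_iso_exists:
  "\<exists>m a (phi :: (pedge list \<Rightarrow> 'k::field) \<Rightarrow> 'k rmat). tiled_exponents m a \<and> jac_tiled_iso n D m a phi"
proof -
  define m where "m = card (edges n D)"
  obtain ed where ed: "bij_betw ed {..<m} (edges n D)"
    using ex_bij_betw_nat_finite[OF finite_edges] by (auto simp: m_def atLeast0LessThan)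
  have ed_edge: "ed i \<in> edges n D" if "i < m" for i
    using bij_betwE[OF ed] that by simp
  have ed_inj: "ed i = ed j \<longleftrightarrow> i = j" if "i < m" "j < m" for i j
    using bij_betw_imp_inj_on[OF ed] that by (auto dest: inj_onD)
  define a where "a i j = int (min_weight (ed i) (ed j))" for i j
  define phi :: "(pedge list \<Rightarrow> 'k) \<Rightarrow> 'k rmat" where
    "phi f i j = (if i < m \<and> j < m then fpoly (entry f (ed i) (ed j)) else 0)" for f i j
  have "tiled_exponents m a"
    using min_weight_triangle ed_edge by (auto simp: tiled_exponents_def a_def simp flip: of_nat_add)
  moreover have "phi (padd f g) = mat_add (phi f) (phi g)"
    if "f \<in> path_alg n D" "g \<in> path_alg n D" for f g
    using entry_padd[OF that] by (intro ext) (simp add: phi_def mat_add_def fpoly_add)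
  moreover have "phi (psmult c f) = mat_scal c (phi f)" if "f \<in> path_alg n D" for f c
    using entry_psmult[OF that] by (intro ext) (simp add: phi_def mat_scal_def flip: fpoly_mult)
  moreover have "phi (pmult f g) = mat_mult m (phi f) (phi g)"
    if "f \<in> path_alg n D" "g \<in> path_alg n D" for f g
  proof (intro ext)
    fix i j
    have "entry (pmult f g) e h = (\<Sum>k<m. entry f e (ed k) * entry g (ed k) h)" for e h
      unfolding entry_pmult[OF that] by (rule sum.reindex_bij_betw[OF ed, symmetric])
    then show "phi (pmult f g) i j = mat_mult m (phi f) (phi g) i j"
      by (simp add: phi_def mat_mult_def fpoly_sum fpoly_mult)
  qed
  moreover have "phi (pone n D) = mat_one m"
  proof (intro ext)
    fix i j
    show "phi (pone n D) i j = mat_one m i j"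
      using entry_pone[OF ed_edge, of i "ed j", where 'k = 'k] ed_inj[of i j]
      by (auto simp: phi_def mat_one_def)
  qed
  moreover have "{f \<in> path_alg n D. phi f = (\<lambda>_ _. 0)} = jac_ideal n D"
  proof (intro set_eqI iffI)
    fix f assume f: "f \<in> {f \<in> path_alg n D. phi f = (\<lambda>_ _. 0)}"
    have "entry f e h = 0" if eh: "e \<in> edges n D" "h \<in> edges n D" for e h
    proof -
      obtain i j where "i < m" "j < m" "e = ed i" "h = ed j"
        using eh bij_betw_imp_surj_on[OF ed] by (metis imageE lessThan_iff)
      moreover have "phi f i j = 0" using f by simp
      ultimately show ?thesis by (simp add: phi_def fpoly_eq_0_iff)
    qed
    then show "f \<in> jac_ideal n D" using f entry_zero_jac_ideal by blast
  next
    fix f :: "pedge list \<Rightarrow> 'k" assume "f \<in> jac_ideal n D"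
    then show "f \<in> {f \<in> path_alg n D. phi f = (\<lambda>_ _. 0)}"
      using jac_ideal_entry[of f] unfolding phi_def by (intro CollectI conjI ext) (blast, metis fpoly_0)
  qed
  moreover have "phi ` path_alg n D = tiled_order m a"
  proof (intro set_eqI iffI)
    fix M assume "M \<in> phi ` path_alg n D"
    then obtain f where f: "f \<in> path_alg n D" "M = phi f" by blast
    show "M \<in> tiled_order m a"
      unfolding tiled_order_def
    proof (intro CollectI allI conjI impI)
      fix i j assume ij: "i < m \<and> j < m"
      obtain q where "entry f (ed i) (ed j) = q * monom 1 (min_weight (ed i) (ed j))"
        by (rule entry_min_weight[OF f(1)])
      then have "M i j = fpoly (q * monom 1 (min_weight (ed i) (ed j)))"
        using ij by (simp add: f(2) phi_def)
      then show "M i j \<in> xpowR (a i j)"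
        unfolding a_def xpowR_nat by blast
    qed (auto simp: f phi_def)
  next
    fix M :: "'k rmat" assume M: "M \<in> tiled_order m a"
    then have "\<exists>p. M i j = fpoly (p * monom 1 (min_weight (ed i) (ed j)))" if "i < m" "j < m" for i j
      using that by (auto simp: tiled_order_def a_def xpowR_nat)
    then obtain q where q: "\<And>i j. i < m \<Longrightarrow> j < m \<Longrightarrow> M i j = fpoly (q i j * monom 1 (min_weight (ed i) (ed j)))"
      by metis
    define ix where "ix = inv_into {..<m} ed"
    obtain f where f: "f \<in> path_alg n D"
      "\<And>e h. e \<in> edges n D \<Longrightarrow> h \<in> edges n D \<Longrightarrow> entry f e h = q (ix e) (ix h) * monom 1 (min_weight e h)"
      using entry_surjective[of "\<lambda>e h. q (ix e) (ix h)"] by blast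
    have ix: "ix (ed i) = i" if "i < m" for i
      using bij_betw_inv_into_left[OF ed] that by (simp add: ix_def)
    have "phi f = M"
      using f(2) ed_edge ix q M by (intro ext) (auto simp: phi_def tiled_order_def)
    then show "M \<in> phi ` path_alg n D" using f(1) by blast
  qed
  ultimately show ?thesis
    unfolding jac_tiled_iso_def by blast
qed

end

theorem theorem2p9:
  fixes n :: nat and D :: "pedge set"
  assumes "n \<ge> 3" and "is_triangulation n D"
  shows "\<exists>m a (phi :: (pedge list \<Rightarrow> 'k::field) \<Rightarrow> 'k rmat).
           tiled_exponents m a \<and> jac_tiled_iso n D m a phi"
proof -
  interpret triangulated_polygon n D by unfold_locales (fact assms)+
  show ?thesis by (rule jac_tiled_iso_exists)
qed

end
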